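(* Let $G$ be a connected graph with $n\geq 4$ vertices and $m$ edges having $p\geq 1$ vertices of degree $r\geq 1$. Say Brouwer's conjecture holds for $k$ if $S_k(G)\le m+\frac{k(k+1)}{2}$. (i) If $m\geq \frac{(2n-r-1)r}{2}$, then Brouwer's conjecture holds for all integers $k \in [1,r]$. (ii) If $p<\frac{n}{2}$ and $m \geq \frac{(n-1)(3n-1)}{8}-\frac{(n-1-2r)p}{2}$, then Brouwer's conjecture holds for all integers $k \in [r+1,\frac{n-1}{2}]$. (iii) If $p>\frac{n}{2}$ and $m \geq \frac{(n-1)(3n-1)}{8}-\frac{(n-1-2r)p}{2}$, then Brouwer's conjecture holds for all integers $k \in [\frac{n-1}{2},n]$.
   Context: The Laplacian matrix of a graph is $L(G)=D(G)-A(G)$ ($D(G)$ diagonal degree matrix, $A(G)$ adjacency matrix), with eigenvalues $\mu_1\ge\dots\ge\mu_n=0$; $S_k(G)=\sum_{i=1}^k\mu_i$. *)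

theory Defs
  imports
    "Graph_Theory.Digraph_Component"
    "Jordan_Normal_Form.Char_Poly"
begin

text \<open>
  A finite simple graph is an element of the locale \<open>graph\<close> of the digraph library: a
  finite loopless digraph without parallel arcs whose arc relation is symmetric. Each undirected
  edge is thus represented by a pair of opposite arcs; the degree of a vertex is its
  \<^const>\<open>out_degree\<close>, but edges have to be counted as unordered pairs.
\<close>

definition edges :: "('a, 'b) pre_digraph \<Rightarrow> 'a set set" where
  "edges G = {{u, v} | u v. u \<rightarrow>\<^bsub>G\<^esub> v}"

text \<open>
  Matrices are indexed by initial segments of the natural numbers, so the matrices of a graph are
  taken with respect to an enumeration \<open>vs\<close> of its vertices.
\<close>

definition degree_mat :: "('a, 'b) pre_digraph \<Rightarrow> 'a list \<Rightarrow> real mat" where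
  "degree_mat G vs = mat (length vs) (length vs)
     (\<lambda>(i, j). if i = j then real (out_degree G (vs ! i)) else 0)"

definition adjacency_mat :: "('a, 'b) pre_digraph \<Rightarrow> 'a list \<Rightarrow> real mat" where
  "adjacency_mat G vs = mat (length vs) (length vs)
     (\<lambda>(i, j). if vs ! i \<rightarrow>\<^bsub>G\<^esub> vs ! j then 1 else 0)"

definition laplacian_mat :: "('a, 'b) pre_digraph \<Rightarrow> 'a list \<Rightarrow> real mat" where
  "laplacian_mat G vs = degree_mat G vs - adjacency_mat G vs"

text \<open>
  The eigenvalues in non-increasing order, repeated according to multiplicity. Since the Laplacian
  matrix of a graph is real symmetric, its characteristic polynomial splits over the reals and the
  list has length \<open>n\<close>; see \<open>length_laplacian_eigenvalues\<close> below.
\<close>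

definition laplacian_eigenvalues :: "('a, 'b) pre_digraph \<Rightarrow> 'a list \<Rightarrow> real list" where
  "laplacian_eigenvalues G vs =
     rev (sorted_list_of_multiset (proots (char_poly (laplacian_mat G vs))))"

lemma symmetric_eigenvalue_real:
  fixes A :: "real mat"
  assumes A: "A \<in> carrier_mat n n" and sym: "A\<^sup>T = A"
    and ev: "eigenvalue (map_mat complex_of_real A) c"
  shows "c \<in> \<real>"
proof -
  let ?B = "map_mat complex_of_real A"
  have B: "?B \<in> carrier_mat n n" and BT: "?B\<^sup>T = ?B"
    using A sym by (auto simp: map_mat_transpose)
  from ev obtain v where v: "v \<in> carrier_vec n" "v \<noteq> 0\<^sub>v n" and Bv: "?B *\<^sub>v v = c \<cdot>\<^sub>v v"
    using B by (auto simp: eigenvalue_def eigenvector_def)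
  have cv: "conjugate v \<in> carrier_vec n" using v by simp
  have "?B *\<^sub>v conjugate v = conjugate (?B *\<^sub>v v)"
    using A v by (intro eq_vecI) (auto simp: scalar_prod_def)
  then have Bcv: "?B *\<^sub>v conjugate v = cnj c \<cdot>\<^sub>v conjugate v"
    by (auto simp: Bv conjugate_smult_vec)
  have "(?B *\<^sub>v v) \<bullet> conjugate v = v \<bullet> (?B *\<^sub>v conjugate v)"
    using transpose_vec_mult_scalar[OF B cv v(1)] comm_scalar_prod B BT v(1) cv
    by (metis mult_mat_vec_carrier)
  then have "c * (v \<bullet>c v) = cnj c * (v \<bullet>c v)"
    using v cv by (simp add: Bv Bcv)
  moreover have "v \<bullet>c v \<noteq> 0" using v by simp
  ultimately show ?thesis by (simp add: Reals_cnj_iff)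
qed

lemma size_proots_symmetric:
  fixes A :: "real mat"
  assumes A: "A \<in> carrier_mat n n" and sym: "A\<^sup>T = A"
  shows "size (proots (char_poly A)) = n"
proof -
  interpret cp: map_poly_inj_idom_hom complex_of_real ..
  let ?B = "map_mat complex_of_real A"
  have B: "?B \<in> carrier_mat n n" using A by simp
  obtain as where as: "char_poly ?B = (\<Prod>a\<leftarrow>as. [:- a, 1:])" and len: "length as = n"
    using char_poly_factorized[OF B] by blast
  have "set as \<subseteq> \<real>"
    using symmetric_eigenvalue_real[OF A sym] eigenvalue_root_char_poly[OF B]
    by (auto simp: as poly_prod_list prod_list_zero_iff)
  then have as_Re: "as = map (complex_of_real \<circ> Re) as"
    by (intro map_idI[symmetric]) auto
  have "map_poly complex_of_real (char_poly A) = char_poly ?B"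
    by (rule of_real_hom.char_poly_hom[OF A, symmetric])
  also have "\<dots> = (\<Prod>a\<leftarrow>as. map_poly complex_of_real [:- Re a, 1:])"
    unfolding as by (subst as_Re) (simp add: o_def)
  also have "\<dots> = map_poly complex_of_real (\<Prod>a\<leftarrow>as. [:- Re a, 1:])"
    by (induction as) (simp_all del: mult_pCons_left add: cp.hom_mult)
  finally have "char_poly A = (\<Prod>a\<leftarrow>as. [:- Re a, 1:])"
    by (simp only: cp.eq_iff)
  moreover have "proots (\<Prod>a\<leftarrow>as. [:- Re a, 1:]) = mset (map Re as)"
  proof (induction as)
    case (Cons a as)
    have "(\<Prod>a\<leftarrow>as. [:- Re a, 1:]) \<noteq> 0" by (induction as) (simp_all del: mult_pCons_left)
    then have "proots ([:- Re a, 1:] * (\<Prod>a\<leftarrow>as. [:- Re a, 1:])) = {#Re a#} + mset (map Re as)"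
      by (subst proots_mult) (simp_all del: mult_pCons_left add: Cons.IH)
    then show ?case by (simp del: mult_pCons_left)
  qed simp
  ultimately show ?thesis using len by simp
qed

lemma length_laplacian_eigenvalues:
  assumes "graph G"
  shows "length (laplacian_eigenvalues G vs) = length vs"
proof -
  interpret graph G by fact
  have "(laplacian_mat G vs)\<^sup>T = laplacian_mat G vs"
    by (intro eq_matI)
      (auto simp: laplacian_mat_def degree_mat_def adjacency_mat_def dest: arcs_ends_symmetric[OF sym_arcs])
  moreover have "laplacian_mat G vs \<in> carrier_mat (length vs) (length vs)"
    by (auto simp: laplacian_mat_def degree_mat_def adjacency_mat_def)
  ultimately have "size (proots (char_poly (laplacian_mat G vs))) = length vs"
    by (intro size_proots_symmetric)
  moreover have "length (sorted_list_of_multiset M) = size M" for M :: "real multiset"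
    by (metis mset_sorted_list_of_multiset size_mset)
  ultimately show ?thesis by (simp add: laplacian_eigenvalues_def)
qed

definition laplacian_sum :: "('a, 'b) pre_digraph \<Rightarrow> 'a list \<Rightarrow> nat \<Rightarrow> real" where
  "laplacian_sum G vs k = sum_list (take k (laplacian_eigenvalues G vs))"

definition brouwer_holds :: "('a, 'b) pre_digraph \<Rightarrow> 'a list \<Rightarrow> nat \<Rightarrow> bool" where
  "brouwer_holds G vs k \<longleftrightarrow>
     laplacian_sum G vs k \<le> real (card (edges G)) + real k * (real k + 1) / 2"

end

theory Submission
  imports Defs "Jordan_Normal_Form.Schur_Decomposition"
begin

text \<open>
  For every set \<open>P\<close> of vertices with complement \<open>Q\<close>, \<open>q = |Q|\<close>, one has
  \<open>S_k(G) \<le> q k + (\<Sum>v\<in>P. deg v)\<close>, a weak form of the Grone--Merris bound. Taking \<open>P = {}\<close> gives (i);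
  taking for \<open>P\<close> the vertices of degree \<open>r\<close> gives (ii) and (iii), because \<open>q k - k (k + 1) / 2\<close> is
  concave in \<open>k\<close> and the hypothesis on \<open>m\<close> is the required inequality at \<open>k = (n - 1) / 2\<close>.

  Completing \<open>Q\<close> to a clique and splitting off the edges inside \<open>P\<close> (which cost at most their trace),
  the variational principle reduces the bound to \<open>\<Sum>(\<mu>_i - q)\<^sup>+ \<le> e(P, Q)\<close> for the
  eigenvalues of a split graph. Let \<open>B\<close> be the \<open>Q \<times> P\<close> biadjacency matrix, \<open>C = J - B\<close>, \<open>D\<close> the diagonal
  matrix of row sums of \<open>B\<close>, and \<open>S\<close> that of column sums of \<open>C\<close>. Up to signs and a rank-one update
  along the all-ones eigenvector, which only trades the eigenvalue \<open>-q\<close> for \<open>0\<close>, the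
  shifted Laplacian is \<open>[[D, -C], [B\<^sup>T, -S]]\<close>. Since \<open>[[D, -C], [-B\<^sup>T, S]]\<close> is an M-matrix with zero column
  sums, the Riccati equation \<open>X D + S X = B\<^sup>T + X C X\<close> has a minimal nonnegative solution \<open>X\<close>, and it
  block-triangularises the matrix into \<open>D - C X\<close>, with eigenvalues \<open>\<ge> 0\<close>, and \<open>-(S - X C)\<close>, with
  eigenvalues \<open>\<le> 0\<close>. Hence the positive part of the spectrum sums to \<open>tr (D - C X) \<le> tr D = e(P, Q)\<close>.
\<close>

section \<open>Z-matrices\<close>

text \<open>Add up the rows indexed by the set \<open>N\<close> of negative entries. The column sums
  \<open>t j\<close> over \<open>N\<close> are positive for \<open>j\<close> in \<open>N\<close> and
  nonpositive elsewhere, so every \<open>t j * v j\<close> is at most 0 and those in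
  \<open>N\<close> are negative, against a nonnegative total.\<close>

lemma nonneg_of_Z_mat_mult_nonneg:
  fixes a :: "nat \<Rightarrow> nat \<Rightarrow> real"
  assumes off: "\<And>i j. i < n \<Longrightarrow> j < n \<Longrightarrow> i \<noteq> j \<Longrightarrow> a i j \<le> 0"
    and col: "\<And>j. j < n \<Longrightarrow> (\<Sum>i<n. a i j) > 0"
    and av: "\<And>i. i < n \<Longrightarrow> (\<Sum>j<n. a i j * v j) \<ge> 0"
    and "i < n"
  shows "v i \<ge> 0"
proof (rule ccontr)
  assume neg: "\<not> v i \<ge> 0"
  define N where "N = {j. j < n \<and> v j < 0}"
  have N: "N \<subseteq> {..<n}" "finite N" "i \<in> N" using neg \<open>i < n\<close> by (auto simp: N_def)
  define t where "t j = (\<Sum>k\<in>N. a k j)" for j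
  have "0 \<le> (\<Sum>k\<in>N. \<Sum>j<n. a k j * v j)" using av N by (intro sum_nonneg[of N]) blast
  also have "\<dots> = (\<Sum>j<n. t j * v j)"
    unfolding t_def sum_distrib_right by (rule sum.swap)
  also have "\<dots> < 0"
  proof -
    have tN: "t j * v j < 0" if "j \<in> N" for j
    proof -
      have "(\<Sum>k<n. a k j) = t j + (\<Sum>k\<in>{..<n} - N. a k j)"
        unfolding t_def using N by (subst sum.subset_diff[of N]) auto
      moreover have "(\<Sum>k\<in>{..<n} - N. a k j) \<le> 0"
        using that N by (intro sum_nonpos off) auto
      ultimately have "t j > 0" using col[of j] that N by auto
      then show ?thesis using that by (simp add: N_def mult_pos_neg)
    qed
    have "t j * v j \<le> 0" if "j < n" for j
    proof (cases "j \<in> N")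
      case False
      then have "t j \<le> 0" unfolding t_def using that N by (intro sum_nonpos off) auto
      then show ?thesis using False that by (simp add: N_def mult_nonpos_nonneg)
    qed (use tN in force)
    then have "(\<Sum>j<n. t j * v j) < (\<Sum>j<n. 0)"
      using tN[OF N(3)] \<open>i < n\<close> by (intro sum_strict_mono_ex1) auto
    then show ?thesis by simp
  qed
  finally show False by simp
qed

text \<open>The preceding sign principle, applied to a kernel vector and its negative, gives
  invertibility; applied to the solution of \<open>A v = 1\<close> it gives nonnegativity. A zero
  entry \<open>v i\<close> would leave only nonpositive terms in row \<open>i\<close>, whose sum is
  1.\<close>

lemma Z_mat_solution:
  fixes a :: "nat \<Rightarrow> nat \<Rightarrow> real"
  assumes off: "\<And>i j. i < n \<Longrightarrow> j < n \<Longrightarrow> i \<noteq> j \<Longrightarrow> a i j \<le> 0"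
    and col: "\<And>j. j < n \<Longrightarrow> (\<Sum>i<n. a i j) > 0"
  obtains v where "\<And>i. i < n \<Longrightarrow> v i > 0" "\<And>i. i < n \<Longrightarrow> (\<Sum>j<n. a i j * v j) = 1"
proof -
  define A where "A = mat n n (\<lambda>(i, j). a i j)"
  have A: "A \<in> carrier_mat n n" by (simp add: A_def)
  have Av: "(A *\<^sub>v w) $ i = (\<Sum>j<n. a i j * w $ j)" if "w \<in> carrier_vec n" "i < n" for w i
    using that by (simp add: A_def scalar_prod_def lessThan_atLeast0)
  have "det A \<noteq> 0"
  proof
    assume "det A = 0"
    then obtain w where w: "w \<in> carrier_vec n" "w \<noteq> 0\<^sub>v n" "A *\<^sub>v w = 0\<^sub>v n"
      using det_0_iff_vec_prod_zero[OF A] by auto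
    have s0: "(\<Sum>j<n. a i j * w $ j) = 0" if "i < n" for i
      using Av[OF w(1) that] w(3) that by simp
    have "w $ i = 0" if "i < n" for i
    proof -
      have "w $ i \<ge> 0"
        using nonneg_of_Z_mat_mult_nonneg[OF off col, where v = "\<lambda>j. w $ j" and i = i] s0 that by simp
      moreover have "- w $ i \<ge> 0"
        using nonneg_of_Z_mat_mult_nonneg[OF off col, where v = "\<lambda>j. - w $ j" and i = i] s0 that
        by (simp add: sum_negf)
      ultimately show ?thesis by simp
    qed
    then have "w = 0\<^sub>v n" using w(1) by (intro eq_vecI) auto
    then show False using w by simp
  qed
  from det_non_zero_imp_unit[OF A this] obtain B where B: "B \<in> carrier_mat n n" "A * B = 1\<^sub>m n"
    unfolding Units_def by (auto simp: ring_mat_def)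
  define v where "v = B *\<^sub>v vec n (\<lambda>_. 1)"
  have v: "v \<in> carrier_vec n" using B by (auto simp: v_def)
  have "A *\<^sub>v v = vec n (\<lambda>_. 1)"
    unfolding v_def using A B by (subst assoc_mult_mat_vec[symmetric, of _ n n _ n]) auto
  then have eq: "(\<Sum>j<n. a i j * v $ j) = 1" if "i < n" for i
    using Av[OF v that] that by simp
  then have nn: "v $ i \<ge> 0" if "i < n" for i
    using nonneg_of_Z_mat_mult_nonneg[OF off col, where v = "\<lambda>j. v $ j" and i = i] that by simp
  have "v $ i > 0" if "i < n" for i
  proof (rule ccontr)
    assume "\<not> v $ i > 0"
    then have "v $ i = 0" using nn[OF that] by simp
    then have "(\<Sum>j<n. a i j * v $ j) \<le> 0"
      using off[OF that] nn by (intro sum_nonpos) (metis lessThan_iff mult_nonpos_nonneg mult_zero_right order_refl)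
    then show False using eq[OF that] by simp
  qed
  with eq that show ?thesis by blast
qed

text \<open>Gershgorin's argument in the maximum norm weighted by \<open>v\<close>: in the row
  maximising \<open>f\<close>, the eigenvalue lies in the disc centred at the diagonal entry with
  that same entry as radius, hence in the closed right half-plane.\<close>

lemma Z_mat_eigenvalue_Re_nonneg:
  fixes A :: "real mat"
  assumes A: "A \<in> carrier_mat n n"
    and off: "\<And>i j. i < n \<Longrightarrow> j < n \<Longrightarrow> i \<noteq> j \<Longrightarrow> A $$ (i, j) \<le> 0"
    and v: "\<And>i. i < n \<Longrightarrow> v i > 0"
    and Av: "\<And>i. i < n \<Longrightarrow> (\<Sum>j<n. A $$ (i, j) * v j) \<ge> 0"
    and ev: "eigenvalue (map_mat complex_of_real A) c"
  shows "Re c \<ge> 0"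
proof -
  let ?B = "map_mat complex_of_real A"
  from ev obtain z where z: "z \<in> carrier_vec n" "z \<noteq> 0\<^sub>v n" and Bz: "?B *\<^sub>v z = c \<cdot>\<^sub>v z"
    using A by (auto simp: eigenvalue_def eigenvector_def)
  from z have "n \<noteq> 0" by (metis carrier_vecD eq_vecI index_zero_vec(2) not_less_zero)
  define f where "f i = cmod (z $ i) / v i" for i
  obtain i where i: "i < n" and imax: "\<And>j. j < n \<Longrightarrow> f j \<le> f i"
  proof -
    have "Max (f ` {..<n}) \<in> f ` {..<n}" using \<open>n \<noteq> 0\<close> by (intro Max_in) auto
    then obtain i where "i < n" "Max (f ` {..<n}) = f i" by auto
    then show ?thesis using that[of i] Max_ge[of "f ` {..<n}"] by force
  qed
  have zi: "cmod (z $ i) > 0"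
  proof (rule ccontr)
    assume "\<not> cmod (z $ i) > 0"
    then have "f i = 0" by (simp add: f_def)
    have "z $ j = 0" if "j < n" for j
      using imax[OF that] v[OF that] \<open>f i = 0\<close> by (auto simp: f_def divide_le_0_iff)
    then have "z = 0\<^sub>v n" using z by (intro eq_vecI) auto
    then show False using z by simp
  qed
  have "(\<Sum>j<n. complex_of_real (A $$ (i, j)) * z $ j) = c * z $ i"
    using arg_cong[OF Bz, of "\<lambda>w. w $ i"] A z i
    by (simp add: scalar_prod_def lessThan_atLeast0)
  moreover have "(\<Sum>j<n. complex_of_real (A $$ (i, j)) * z $ j)
      = A $$ (i, i) * z $ i + (\<Sum>j\<in>{..<n} - {i}. complex_of_real (A $$ (i, j)) * z $ j)"
    using i by (subst sum.remove[of _ i]) auto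
  ultimately have "(c - A $$ (i, i)) * z $ i = (\<Sum>j\<in>{..<n} - {i}. complex_of_real (A $$ (i, j)) * z $ j)"
    by (simp add: algebra_simps)
  then have "cmod (c - A $$ (i, i)) * cmod (z $ i)
      = cmod (\<Sum>j\<in>{..<n} - {i}. complex_of_real (A $$ (i, j)) * z $ j)"
    by (metis norm_mult)
  also have "\<dots> \<le> (\<Sum>j\<in>{..<n} - {i}. cmod (complex_of_real (A $$ (i, j)) * z $ j))"
    by (rule norm_sum)
  also have "\<dots> \<le> (\<Sum>j\<in>{..<n} - {i}. - A $$ (i, j) * (f i * v j))"
  proof (rule sum_mono)
    fix j assume j: "j \<in> {..<n} - {i}"
    have "cmod (z $ j) \<le> f i * v j"
      using imax[of j] v[of j] j by (simp add: f_def field_simps)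
    then show "cmod (complex_of_real (A $$ (i, j)) * z $ j) \<le> - A $$ (i, j) * (f i * v j)"
      using off[of i j] i j by (simp add: norm_mult mult_left_mono_neg)
  qed
  also have "\<dots> = f i * (\<Sum>j\<in>{..<n} - {i}. - A $$ (i, j) * v j)"
    by (simp add: sum_distrib_left algebra_simps)
  also have "\<dots> \<le> f i * (A $$ (i, i) * v i)"
    using Av[OF i] i v[OF i]
    by (intro mult_left_mono) (auto simp: sum_negf f_def sum.remove[of "{..<n}" i])
  also have "f i * (A $$ (i, i) * v i) = A $$ (i, i) * cmod (z $ i)"
    using v[OF i] by (simp add: f_def)
  finally have "cmod (c - A $$ (i, i)) \<le> A $$ (i, i)"
    using zi by simp
  moreover have "\<bar>Re (c - A $$ (i, i))\<bar> \<le> cmod (c - A $$ (i, i))" by (rule abs_Re_le_cmod)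
  ultimately show ?thesis by simp
qed

text \<open>Unlike nonsingularity, this quantitative form survives passing to a limit of matrices.\<close>

lemma abs_poly_char_poly_Z_mat:
  fixes A :: "real mat"
  assumes A: "A \<in> carrier_mat n n"
    and off: "\<And>i j. i < n \<Longrightarrow> j < n \<Longrightarrow> i \<noteq> j \<Longrightarrow> A $$ (i, j) \<le> 0"
    and v: "\<And>i. i < n \<Longrightarrow> v i > 0"
    and Av: "\<And>i. i < n \<Longrightarrow> (\<Sum>j<n. A $$ (i, j) * v j) \<ge> 0"
    and t: "t \<le> 0"
  shows "\<bar>poly (char_poly A) t\<bar> \<ge> \<bar>t\<bar> ^ n"
proof -
  let ?B = "map_mat complex_of_real A"
  have B: "?B \<in> carrier_mat n n" using A by simp
  obtain as where as: "char_poly ?B = (\<Prod>a\<leftarrow>as. [:- a, 1:])" and len: "length as = n"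
    using char_poly_factorized[OF B] by blast
  have "Re a \<ge> 0" if "a \<in> set as" for a
    using that Z_mat_eigenvalue_Re_nonneg[OF A off v Av] eigenvalue_root_char_poly[OF B]
    by (auto simp: as poly_prod_list prod_list_zero_iff)
  \<comment> \<open>No root has negative real part and \<open>t\<close> is nonpositive, so
    \<open>t\<close> is at distance at least \<open>|t|\<close> from each of the \<open>n\<close>
    roots.\<close>
  then have le: "\<bar>t\<bar> \<le> cmod (complex_of_real t - a)" if "a \<in> set as" for a
    using that t abs_Re_le_cmod[of "complex_of_real t - a"] by fastforce
  have "complex_of_real (poly (char_poly A) t) = poly (map_poly complex_of_real (char_poly A)) (complex_of_real t)"
    by simp
  also have "map_poly complex_of_real (char_poly A) = char_poly ?B"
    by (rule of_real_hom.char_poly_hom[OF A, symmetric])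
  also have "poly \<dots> (complex_of_real t) = (\<Prod>a\<leftarrow>as. complex_of_real t - a)"
    unfolding as poly_prod_list by (simp add: o_def)
  finally have "\<bar>poly (char_poly A) t\<bar> = cmod (\<Prod>a\<leftarrow>as. complex_of_real t - a)"
    by (metis norm_of_real real_norm_def)
  moreover have "\<bar>t\<bar> ^ length as \<le> cmod (\<Prod>a\<leftarrow>as. complex_of_real t - a)"
    using le by (induction as) (auto simp: norm_mult intro!: mult_mono)
  ultimately show ?thesis using len by simp
qed

text \<open>By the Leibniz formula the value at a fixed \<open>t\<close> is a polynomial in the
  matrix entries, hence continuous in them.\<close>

lemma tendsto_poly_char_poly:
  fixes A :: "'b \<Rightarrow> real mat"
  assumes A: "\<And>x. A x \<in> carrier_mat n n" and B: "B \<in> carrier_mat n n"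
    and lim: "\<And>i j. i < n \<Longrightarrow> j < n \<Longrightarrow> ((\<lambda>x. A x $$ (i, j)) \<longlongrightarrow> B $$ (i, j)) F"
  shows "((\<lambda>x. poly (char_poly (A x)) t) \<longlongrightarrow> poly (char_poly B) t) F"
proof -
  have eq: "poly (char_poly M) t = (\<Sum>\<pi> | \<pi> permutes {0..<n}.
      signof \<pi> * (\<Prod>i = 0..<n. (if i = \<pi> i then t else 0) - M $$ (i, \<pi> i)))"
    if "M \<in> carrier_mat n n" for M :: "real mat"
  proof -
    have "- char_matrix M t \<in> carrier_mat n n" using that by simp
    moreover have "(- char_matrix M t) $$ (i, \<pi> i) = (if i = \<pi> i then t else 0) - M $$ (i, \<pi> i)"
      if "\<pi> permutes {0..<n}" "i < n" for \<pi> i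
      using \<open>M \<in> _\<close> that permutes_in_image[OF that(1), of i] by (simp add: char_matrix_def)
    ultimately show ?thesis
      unfolding char_poly_matrix[OF that] by (simp add: det_def' del: index_uminus_mat)
  qed
  have perm: "\<pi> i < n" if "\<pi> permutes {0..<n}" "i < n" for \<pi> i
    using permutes_in_image[OF that(1), of i] that by simp
  show ?thesis
    unfolding eq[OF A] eq[OF B] by (intro tendsto_intros lim) (auto simp: perm)
qed

section \<open>A nonsymmetric Riccati equation\<close>

text \<open>Rows \<open>i < q\<close> index the clique side, columns \<open>v < p\<close> the independent side.\<close>

locale bipartite_weights =
  fixes q p :: nat and b :: "nat \<Rightarrow> nat \<Rightarrow> real"
  assumes b_nonneg: "i < q \<Longrightarrow> v < p \<Longrightarrow> 0 \<le> b i v"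
    and b_le_1: "i < q \<Longrightarrow> v < p \<Longrightarrow> b i v \<le> 1"
begin

definition c :: "nat \<Rightarrow> nat \<Rightarrow> real" where "c i v = 1 - b i v"
definition d :: "nat \<Rightarrow> real" where "d i = (\<Sum>v<p. b i v)"
definition s :: "nat \<Rightarrow> real" where "s v = (\<Sum>i<q. c i v)"

lemma c_nonneg: "i < q \<Longrightarrow> v < p \<Longrightarrow> 0 \<le> c i v"
  using b_le_1 by (simp add: c_def)

lemma d_nonneg: "i < q \<Longrightarrow> d i \<ge> 0"
  by (auto simp: d_def intro!: sum_nonneg b_nonneg)

lemma s_nonneg: "v < p \<Longrightarrow> s v \<ge> 0"
  by (auto simp: s_def intro!: sum_nonneg c_nonneg)

text \<open>\<open>b i v\<close> is a term of \<open>d i\<close> and \<open>1 - b i v\<close> a term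
  of \<open>s v\<close>. The denominators of the Riccati iteration thus stay away from 0 even
  without perturbation.\<close>

lemma s_plus_d: assumes "i < q" "v < p" shows "s v + d i \<ge> 1"
proof -
  have "b i v \<le> d i" unfolding d_def using assms b_nonneg by (intro member_le_sum) auto
  moreover have "c i v \<le> s v" unfolding s_def using assms c_nonneg by (intro member_le_sum) auto
  ultimately show ?thesis by (simp add: c_def)
qed

text \<open>
  For \<open>e > 0\<close> the M-matrix perturbed by \<open>e\<close> times the identity is nonsingular, which provides a positive
  vector certifying that the closed loop has eigenvalues in the right half-plane. At \<open>e = 0\<close> such a vector
  need not exist, so this property is transferred to the limit.
\<close>

fun riccati :: "real \<Rightarrow> nat \<Rightarrow> nat \<Rightarrow> nat \<Rightarrow> real" where
  "riccati e 0 v i = 0"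
| "riccati e (Suc k) v i =
    (b i v + (\<Sum>j<q. \<Sum>w<p. riccati e k v j * c j w * riccati e k w i)) / (s v + d i + 2 * e)"

declare riccati.simps(2) [simp del]

section \<open>The monotone Riccati iteration\<close>

lemma denom_pos: "i < q \<Longrightarrow> v < p \<Longrightarrow> e \<ge> 0 \<Longrightarrow> s v + d i + 2 * e > 0"
  using s_plus_d[of i v] by simp

lemma riccati_step:
  assumes "i < q" "v < p" "e \<ge> 0"
  shows "riccati e (Suc k) v i * (s v + d i + 2 * e)
    = b i v + (\<Sum>j<q. \<Sum>w<p. riccati e k v j * c j w * riccati e k w i)"
  using denom_pos[OF assms] by (simp add: riccati.simps(2))

lemma riccati_nonneg: "i < q \<Longrightarrow> v < p \<Longrightarrow> e \<ge> 0 \<Longrightarrow> riccati e k v i \<ge> 0"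
proof (induction k arbitrary: v i)
  case (Suc k)
  have "(\<Sum>j<q. \<Sum>w<p. riccati e k v j * c j w * riccati e k w i) \<ge> 0"
    using Suc c_nonneg by (intro sum_nonneg) auto
  then show ?case using denom_pos[of i v e] Suc.prems b_nonneg by (simp add: riccati.simps(2))
qed simp

text \<open>All coefficients are nonnegative, so the iteration map preserves the entrywise order of
  nonnegative matrices; the first iterate dominates the start 0, and induction propagates
  this.\<close>

lemma riccati_le_Suc: "i < q \<Longrightarrow> v < p \<Longrightarrow> e \<ge> 0 \<Longrightarrow> riccati e k v i \<le> riccati e (Suc k) v i"
proof (induction k arbitrary: v i)
  case 0
  then show ?case using riccati_nonneg[of i v e "Suc 0"] by simp
next
  case (Suc k)
  have "(\<Sum>j<q. \<Sum>w<p. riccati e k v j * c j w * riccati e k w i)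
      \<le> (\<Sum>j<q. \<Sum>w<p. riccati e (Suc k) v j * c j w * riccati e (Suc k) w i)"
    using Suc.IH Suc.prems c_nonneg riccati_nonneg
    by (intro sum_mono mult_mono mult_right_mono mult_nonneg_nonneg) (auto)
  then have "riccati e (Suc k) v i * (s v + d i + 2 * e) \<le> riccati e (Suc (Suc k)) v i * (s v + d i + 2 * e)"
    unfolding riccati_step[OF Suc.prems] by simp
  then show ?case
    using denom_pos[OF Suc.prems] by (rule mult_right_le_imp_le)
qed

text \<open>Summing the recursion over \<open>v\<close> turns the quadratic term, by the induction
  hypothesis, into at most the \<open>s\<close>-weighted column sum of the old iterate. Monotonicity
  bounds it by that of the new one, which cancels the \<open>s\<close>-part of the left
  side.\<close>

lemma riccati_col_sum_pos:
  assumes "i < q" "e > 0"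
  shows "(\<Sum>v<p. riccati e k v i) \<le> 1"
  using assms(1)
proof (induction k arbitrary: i)
  case (Suc k)
  let ?X = "riccati e k" and ?Y = "riccati e (Suc k)"
  let ?S = "\<Sum>v<p. \<Sum>j<q. \<Sum>w<p. ?X v j * c j w * ?X w i"
  have Y: "(\<Sum>v<p. ?Y v i * (s v + d i + 2 * e)) = d i + ?S"
    unfolding d_def sum.distrib[symmetric]
    using Suc.prems assms(2) by (intro sum.cong refl riccati_step[unfolded d_def]) auto
  have "?S = (\<Sum>j<q. \<Sum>v<p. \<Sum>w<p. ?X v j * c j w * ?X w i)"
    by (rule sum.swap)
  also have "\<dots> = (\<Sum>j<q. \<Sum>w<p. \<Sum>v<p. ?X v j * c j w * ?X w i)"
    by (intro sum.cong refl sum.swap)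
  also have "\<dots> = (\<Sum>j<q. \<Sum>w<p. (\<Sum>v<p. ?X v j) * (c j w * ?X w i))"
    by (simp add: sum_distrib_right mult.assoc)
  also have "\<dots> \<le> (\<Sum>j<q. \<Sum>w<p. 1 * (c j w * ?X w i))"
    using Suc c_nonneg riccati_nonneg assms
    by (intro sum_mono mult_right_mono mult_nonneg_nonneg) auto
  also have "\<dots> = (\<Sum>w<p. s w * ?X w i)"
    unfolding s_def sum_distrib_right mult_1_left by (rule sum.swap)
  also have "\<dots> \<le> (\<Sum>w<p. s w * ?Y w i)"
    using riccati_le_Suc s_nonneg Suc.prems assms(2) by (intro sum_mono mult_left_mono) auto
  finally have "(\<Sum>v<p. ?Y v i) * (d i + 2 * e) \<le> 1 * d i"
    using Y by (simp add: algebra_simps sum.distrib sum_distrib_left sum_distrib_right)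
  \<comment> \<open>\<open>d i\<close> may vanish, so the division relies on \<open>e > 0\<close>;
    the bound at \<open>e = 0\<close> is recovered as a limit.\<close>
  also have "\<dots> \<le> 1 * (d i + 2 * e)" using assms by simp
  finally show ?case
    by (rule mult_right_le_imp_le) (use d_nonneg[OF Suc.prems] assms in simp)
qed simp

text \<open>The perturbed M-matrix maps \<open>(x, y)\<close> to a nonnegative vector, and the
  iteration preserves \<open>X x \<le> y\<close>: the quadratic term applied to \<open>x\<close> is
  at most \<open>X C y\<close>, hence at most the next iterate times \<open>(D + e) x\<close>, which
  cancels on the left. Of the shift \<open>2 * e\<close>, one half goes with \<open>d i\<close> and
  the other with \<open>s v\<close>.\<close>

lemma riccati_weighted_row_sum:
  assumes e: "e > 0"
    and x: "\<And>i. i < q \<Longrightarrow> x i \<ge> 0" and y: "\<And>v. v < p \<Longrightarrow> y v \<ge> 0"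
    and cy: "\<And>i. i < q \<Longrightarrow> (\<Sum>w<p. c i w * y w) \<le> (d i + e) * x i"
    and bx: "\<And>v. v < p \<Longrightarrow> (\<Sum>i<q. b i v * x i) \<le> (s v + e) * y v"
    and "v < p"
  shows "(\<Sum>i<q. riccati e k v i * x i) \<le> y v"
  using \<open>v < p\<close>
proof (induction k arbitrary: v)
  case 0
  then show ?case using y by simp
next
  case (Suc k)
  let ?X = "riccati e k" and ?Y = "riccati e (Suc k)"
  let ?S = "\<Sum>i<q. \<Sum>j<q. \<Sum>w<p. ?X v j * c j w * ?X w i * x i"
  have "(\<Sum>i<q. ?Y v i * (s v + d i + 2 * e) * x i)
      = (\<Sum>i<q. (b i v + (\<Sum>j<q. \<Sum>w<p. ?X v j * c j w * ?X w i)) * x i)"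
    using Suc.prems e by (intro sum.cong refl arg_cong2[of _ _ _ _ "(*)"] riccati_step) auto
  also have "\<dots> = (\<Sum>i<q. b i v * x i) + ?S"
    by (simp add: sum.distrib distrib_right sum_distrib_right)
  finally have Y: "(\<Sum>i<q. ?Y v i * (s v + d i + 2 * e) * x i) = (\<Sum>i<q. b i v * x i) + ?S" .
  have "?S = (\<Sum>j<q. \<Sum>i<q. \<Sum>w<p. ?X v j * c j w * ?X w i * x i)"
    by (rule sum.swap)
  also have "\<dots> = (\<Sum>j<q. \<Sum>w<p. \<Sum>i<q. ?X v j * c j w * ?X w i * x i)"
    by (intro sum.cong refl sum.swap)
  also have "\<dots> = (\<Sum>j<q. \<Sum>w<p. (?X v j * c j w) * (\<Sum>i<q. ?X w i * x i))"
    by (simp add: sum_distrib_left mult.assoc)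
  also have "\<dots> \<le> (\<Sum>j<q. \<Sum>w<p. (?X v j * c j w) * y w)"
    using Suc c_nonneg riccati_nonneg e
    by (intro sum_mono mult_left_mono mult_nonneg_nonneg) auto
  also have "\<dots> = (\<Sum>j<q. ?X v j * (\<Sum>w<p. c j w * y w))"
    by (simp add: sum_distrib_left mult.assoc)
  also have "\<dots> \<le> (\<Sum>j<q. ?Y v j * ((d j + e) * x j))"
  proof (intro sum_mono mult_mono)
    fix j assume j: "j \<in> {..<q}"
    show "?X v j \<le> ?Y v j" using riccati_le_Suc j Suc.prems e by simp
    show "(\<Sum>w<p. c j w * y w) \<le> (d j + e) * x j" using cy j by simp
    show "?Y v j \<ge> 0" using riccati_nonneg[of j v e "Suc k"] j Suc.prems e by simp
    show "(\<Sum>w<p. c j w * y w) \<ge> 0" using j c_nonneg y by (intro sum_nonneg mult_nonneg_nonneg) auto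
  qed
  finally have "?S \<le> (\<Sum>j<q. ?Y v j * ((d j + e) * x j))" .
  moreover have "(\<Sum>i<q. ?Y v i * (s v + d i + 2 * e) * x i)
      = (\<Sum>i<q. ?Y v i * x i) * (s v + e) + (\<Sum>j<q. ?Y v j * ((d j + e) * x j))"
    unfolding sum_distrib_right sum.distrib[symmetric] by (simp add: algebra_simps)
  ultimately have "(\<Sum>i<q. ?Y v i * x i) * (s v + e) \<le> (\<Sum>i<q. b i v * x i)"
    using Y by linarith
  also have "\<dots> \<le> y v * (s v + e)" using bx[OF Suc.prems] by (simp add: mult.commute)
  finally show ?case
    by (rule mult_right_le_imp_le) (use s_nonneg[OF Suc.prems] e in simp)
qed

lemma tendsto_riccati:
  "i < q \<Longrightarrow> v < p \<Longrightarrow> ((\<lambda>e. riccati e k v i) \<longlongrightarrow> riccati 0 k v i) (at_right 0)"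
proof (induction k arbitrary: v i)
  case (Suc k)
  have "((\<lambda>e. s v + d i + 2 * e) \<longlongrightarrow> s v + d i + 2 * 0) (at_right 0)"
    by (intro tendsto_intros)
  then show ?case
    unfolding riccati.simps using Suc denom_pos[of i v 0]
    by (intro tendsto_divide tendsto_add tendsto_sum tendsto_mult tendsto_const) auto
qed simp

lemma riccati_col_sum:
  assumes "i < q" shows "(\<Sum>v<p. riccati 0 k v i) \<le> 1"
proof -
  have "((\<lambda>e. \<Sum>v<p. riccati e k v i) \<longlongrightarrow> (\<Sum>v<p. riccati 0 k v i)) (at_right 0)"
    using assms by (intro tendsto_sum tendsto_riccati) auto
  moreover have "eventually (\<lambda>e. (\<Sum>v<p. riccati e k v i) \<le> 1) (at_right 0)"
    by (rule eventually_mono[OF eventually_at_right_less]) (rule riccati_col_sum_pos[OF assms])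
  ultimately show ?thesis by (rule tendsto_upperbound) simp
qed

section \<open>The limit of the iteration\<close>

definition X :: "nat \<Rightarrow> nat \<Rightarrow> real" where "X v i = lim (\<lambda>k. riccati 0 k v i)"

text \<open>The iterates increase, and nonnegative entries with column sums at most 1 are bounded by
  1.\<close>

lemma riccati_tendsto_X:
  assumes "i < q" "v < p" shows "(\<lambda>k. riccati 0 k v i) \<longlonglongrightarrow> X v i"
proof -
  have "riccati 0 k v i \<le> 1" for k
    using member_le_sum[of v "{..<p}" "\<lambda>v. riccati 0 k v i"] riccati_nonneg[OF assms(1)] assms(2)
      riccati_col_sum[OF assms(1), of k] by fastforce
  moreover have "incseq (\<lambda>k. riccati 0 k v i)"
    by (rule incseq_SucI) (use riccati_le_Suc assms in blast)
  ultimately obtain L where "(\<lambda>k. riccati 0 k v i) \<longlonglongrightarrow> L"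
    by (meson incseq_convergent)
  then show ?thesis unfolding X_def by (simp add: limI)
qed

lemma X_nonneg: "i < q \<Longrightarrow> v < p \<Longrightarrow> X v i \<ge> 0"
  using riccati_tendsto_X by (rule LIMSEQ_le_const) (auto intro: riccati_nonneg)

lemma X_col_sum: assumes "i < q" shows "(\<Sum>v<p. X v i) \<le> 1"
proof -
  have "(\<lambda>k. \<Sum>v<p. riccati 0 k v i) \<longlonglongrightarrow> (\<Sum>v<p. X v i)"
    using assms by (intro tendsto_sum riccati_tendsto_X) auto
  then show ?thesis by (rule LIMSEQ_le_const2) (use riccati_col_sum assms in auto)
qed

lemma X_eq:
  assumes "i < q" "v < p"
  shows "X v i * (s v + d i) = b i v + (\<Sum>j<q. \<Sum>w<p. X v j * c j w * X w i)"
proof (rule LIMSEQ_unique)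
  show "(\<lambda>k. riccati 0 (Suc k) v i * (s v + d i)) \<longlonglongrightarrow> X v i * (s v + d i)"
    using LIMSEQ_Suc[OF riccati_tendsto_X[OF assms]] by (intro tendsto_intros)
  have "(\<lambda>k. b i v + (\<Sum>j<q. \<Sum>w<p. riccati 0 k v j * c j w * riccati 0 k w i))
      \<longlonglongrightarrow> b i v + (\<Sum>j<q. \<Sum>w<p. X v j * c j w * X w i)"
    using assms by (intro tendsto_intros riccati_tendsto_X) auto
  then show "(\<lambda>k. riccati 0 (Suc k) v i * (s v + d i))
      \<longlonglongrightarrow> b i v + (\<Sum>j<q. \<Sum>w<p. X v j * c j w * X w i)"
    using riccati_step[OF assms, of 0] by simp
qed

text \<open>The matrix \<open>diag u - C Z\<close>. Leaving \<open>u\<close> and \<open>Z\<close>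
  free covers the perturbed iterates, the limit, and the copy shifted by \<open>q\<close>.\<close>

definition closed_loop :: "(nat \<Rightarrow> real) \<Rightarrow> (nat \<Rightarrow> nat \<Rightarrow> real) \<Rightarrow> real mat" where
  "closed_loop u Z = mat q q (\<lambda>(i, j). (if i = j then u i else 0) - (\<Sum>w<p. c i w * Z w j))"

lemma closed_loop_carrier [simp]: "closed_loop u Z \<in> carrier_mat q q"
  by (simp add: closed_loop_def)

lemma closed_loop_entry:
  "i < q \<Longrightarrow> j < q \<Longrightarrow> closed_loop u Z $$ (i, j) = (if i = j then u i else 0) - (\<Sum>w<p. c i w * Z w j)"
  by (simp add: closed_loop_def)

lemma tendsto_char_poly_closed_loop:
  assumes "\<And>i. i < q \<Longrightarrow> ((\<lambda>x. u x i) \<longlongrightarrow> u' i) F"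
    and "\<And>i v. i < q \<Longrightarrow> v < p \<Longrightarrow> ((\<lambda>x. Z x v i) \<longlongrightarrow> Z' v i) F"
  shows "((\<lambda>x. poly (char_poly (closed_loop (u x) (Z x))) t) \<longlongrightarrow> poly (char_poly (closed_loop u' Z')) t) F"
proof (rule tendsto_poly_char_poly)
  fix i j assume ij: "i < q" "j < q"
  have "((\<lambda>x. if i = j then u x i else 0) \<longlongrightarrow> (if i = j then u' i else 0)) F"
    using assms(1) ij by (cases "i = j") auto
  then show "((\<lambda>x. closed_loop (u x) (Z x) $$ (i, j)) \<longlongrightarrow> closed_loop u' Z' $$ (i, j)) F"
    unfolding closed_loop_entry[OF ij] using assms(2) ij
    by (intro tendsto_diff tendsto_sum tendsto_mult tendsto_const) auto
qed auto

lemma closed_loop_off_diag: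
  assumes "\<And>i v. i < q \<Longrightarrow> v < p \<Longrightarrow> Z v i \<ge> 0" "i < q" "j < q" "i \<noteq> j"
  shows "closed_loop u Z $$ (i, j) \<le> 0"
  using assms c_nonneg by (auto simp: closed_loop_def intro!: sum_nonneg)

text \<open>The columns of the perturbed M-matrix \<open>[[D + e, -C], [-B^T, S + e]]\<close>, here
  \<open>a\<close>, each sum to exactly \<open>e\<close>, so it maps some positive vector to the
  all-ones vector. The two segments of that vector are \<open>x\<close> and
  \<open>y\<close>.\<close>

lemma perturbed_weights:
  assumes e: "e > 0"
  obtains x y where "\<And>i. i < q \<Longrightarrow> x i > 0" "\<And>v. v < p \<Longrightarrow> y v > 0"
    "\<And>i. i < q \<Longrightarrow> (\<Sum>w<p. c i w * y w) \<le> (d i + e) * x i"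
    "\<And>v. v < p \<Longrightarrow> (\<Sum>i<q. b i v * x i) \<le> (s v + e) * y v"
proof -
  define a where "a k l = (if k < q then if l < q then if k = l then d k + e else 0 else - c k (l - q)
    else if l < q then - b l (k - q) else if k = l then s (k - q) + e else 0)" for k l
  have split: "(\<Sum>l<q + p. f l) = (\<Sum>l<q. f l) + (\<Sum>l<p. f (q + l))" for f :: "nat \<Rightarrow> real"
    by (induction p) (auto simp: add.assoc)
  have "a k l \<le> 0" if "k < q + p" "l < q + p" "k \<noteq> l" for k l
    using that c_nonneg[of k "l - q"] b_nonneg[of l "k - q"] by (auto simp: a_def)
  moreover have "(\<Sum>k<q + p. a k l) > 0" if "l < q + p" for l
  proof (cases "l < q")
    case True
    then have "(\<Sum>k<q. a k l) = (\<Sum>k<q. if k = l then d k + e else 0)"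
      "(\<Sum>k<p. a (q + k) l) = (\<Sum>k<p. - b l k)"
      by (auto simp: a_def intro!: sum.cong)
    then show ?thesis using e True by (simp add: split sum_negf d_def)
  next
    case False
    have "(\<Sum>k<q. a k l) = (\<Sum>k<q. - c k (l - q))"
      "(\<Sum>k<p. a (q + k) l) = (\<Sum>k<p. if k = l - q then s k + e else 0)"
    proof -
      show "(\<Sum>k<q. a k l) = (\<Sum>k<q. - c k (l - q))"
        using False by (intro sum.cong refl) (simp add: a_def)
      show "(\<Sum>k<p. a (q + k) l) = (\<Sum>k<p. if k = l - q then s k + e else 0)"
        using False by (intro sum.cong refl) (auto simp: a_def)
    qed
    moreover have "l - q < p" using False that by simp
    ultimately show ?thesis using e by (simp add: split sum_negf s_def)
  qed
  ultimately obtain v where v: "\<And>i. i < q + p \<Longrightarrow> v i > 0"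
    "\<And>i. i < q + p \<Longrightarrow> (\<Sum>j<q + p. a i j * v j) = 1"
    using Z_mat_solution[of "q + p" a] by metis
  show ?thesis
  proof (rule that[of v "\<lambda>w. v (q + w)"])
    fix i assume i: "i < q"
    have "(\<Sum>l<q. a i l * v l) = (\<Sum>l<q. if l = i then (d i + e) * v i else 0)"
      using i by (intro sum.cong refl) (auto simp: a_def)
    moreover have "(\<Sum>l<p. a i (q + l) * v (q + l)) = - (\<Sum>l<p. c i l * v (q + l))"
      unfolding sum_negf[symmetric] using i by (intro sum.cong refl) (auto simp: a_def)
    ultimately show "(\<Sum>w<p. c i w * v (q + w)) \<le> (d i + e) * v i"
      using v(2)[of i] i by (simp add: split)
  next
    fix w assume w: "w < p"
    have "(\<Sum>l<p. a (q + w) (q + l) * v (q + l)) = (\<Sum>l<p. if l = w then (s w + e) * v (q + w) else 0)"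
      using w by (intro sum.cong refl) (auto simp: a_def)
    moreover have "(\<Sum>l<q. a (q + w) l * v l) = - (\<Sum>l<q. b l w * v l)"
      unfolding sum_negf[symmetric] using w by (intro sum.cong refl) (auto simp: a_def)
    ultimately show "(\<Sum>i<q. b i w * v i) \<le> (s w + e) * v (q + w)"
      using v(2)[of "q + w"] w by (simp add: split)
  qed (use v in auto)
qed

text \<open>The weights \<open>x\<close> serve as positive test vector: with \<open>Z\<close> the
  iterate, the closed loop maps \<open>x\<close> to \<open>(D + e) x - C (Z x)\<close>, which is at
  least \<open>(D + e) x - C y\<close> and so nonnegative.\<close>

lemma closed_loop_perturbed:
  assumes e: "e > 0" and t: "t \<le> 0"
  shows "\<bar>poly (char_poly (closed_loop (\<lambda>i. d i + e) (riccati e k))) t\<bar> \<ge> \<bar>t\<bar> ^ q"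
proof -
  obtain x y where x: "\<And>i. i < q \<Longrightarrow> x i > 0" and y: "\<And>v. v < p \<Longrightarrow> y v > 0"
    and cy: "\<And>i. i < q \<Longrightarrow> (\<Sum>w<p. c i w * y w) \<le> (d i + e) * x i"
    and bx: "\<And>v. v < p \<Longrightarrow> (\<Sum>i<q. b i v * x i) \<le> (s v + e) * y v"
    using perturbed_weights[OF e] by blast
  have "(\<Sum>j<q. closed_loop (\<lambda>i. d i + e) (riccati e k) $$ (i, j) * x j) \<ge> 0" if i: "i < q" for i
  proof -
    have "(\<Sum>j<q. closed_loop (\<lambda>i. d i + e) (riccati e k) $$ (i, j) * x j)
        = (\<Sum>j<q. if j = i then (d i + e) * x i else 0) - (\<Sum>j<q. \<Sum>w<p. c i w * riccati e k w j * x j)"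
      unfolding sum_subtractf[symmetric]
      using i by (intro sum.cong) (auto simp: closed_loop_def left_diff_distrib sum_distrib_right)
    moreover have "(\<Sum>j<q. \<Sum>w<p. c i w * riccati e k w j * x j) = (\<Sum>w<p. c i w * (\<Sum>j<q. riccati e k w j * x j))"
      by (subst sum.swap) (simp add: sum_distrib_left mult.assoc)
    moreover have "(\<Sum>w<p. c i w * (\<Sum>j<q. riccati e k w j * x j)) \<le> (\<Sum>w<p. c i w * y w)"
      using i c_nonneg riccati_weighted_row_sum[OF e less_imp_le[OF x] less_imp_le[OF y] cy bx]
      by (intro sum_mono mult_left_mono) auto
    ultimately show ?thesis using cy[OF i] i by simp
  qed
  then show ?thesis
    using x e t riccati_nonneg
    by (intro abs_poly_char_poly_Z_mat[where v = x] closed_loop_off_diag) auto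
qed

text \<open>Two limits are taken, first \<open>e\<close> to 0 for a fixed iterate and then along the
  iterates. The lower bound depends on neither, so it survives both.\<close>

lemma closed_loop_char_poly:
  assumes t: "t \<le> 0"
  shows "\<bar>poly (char_poly (closed_loop d X)) t\<bar> \<ge> \<bar>t\<bar> ^ q"
proof -
  have fin: "\<bar>poly (char_poly (closed_loop d (riccati 0 k))) t\<bar> \<ge> \<bar>t\<bar> ^ q" for k
  proof -
    have "((\<lambda>e. poly (char_poly (closed_loop (\<lambda>i. d i + e) (riccati e k))) t)
        \<longlongrightarrow> poly (char_poly (closed_loop (\<lambda>i. d i + 0) (riccati 0 k))) t) (at_right 0)"
      by (intro tendsto_char_poly_closed_loop tendsto_riccati tendsto_add tendsto_const tendsto_ident_at)
    then have "((\<lambda>e. \<bar>poly (char_poly (closed_loop (\<lambda>i. d i + e) (riccati e k))) t\<bar>)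
        \<longlongrightarrow> \<bar>poly (char_poly (closed_loop d (riccati 0 k))) t\<bar>) (at_right 0)"
      by (intro tendsto_rabs) simp
    moreover have "eventually (\<lambda>e. \<bar>t\<bar> ^ q \<le> \<bar>poly (char_poly (closed_loop (\<lambda>i. d i + e) (riccati e k))) t\<bar>) (at_right 0)"
      by (rule eventually_mono[OF eventually_at_right_less]) (rule closed_loop_perturbed[OF _ t])
    ultimately show ?thesis by (rule tendsto_lowerbound) simp
  qed
  have "(\<lambda>k. poly (char_poly (closed_loop d (riccati 0 k))) t) \<longlonglongrightarrow> poly (char_poly (closed_loop d X)) t"
    by (intro tendsto_char_poly_closed_loop riccati_tendsto_X tendsto_const)
  then have "(\<lambda>k. \<bar>poly (char_poly (closed_loop d (riccati 0 k))) t\<bar>) \<longlonglongrightarrow> \<bar>poly (char_poly (closed_loop d X)) t\<bar>"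
    by (rule tendsto_rabs)
  then show ?thesis by (rule LIMSEQ_le_const) (use fin in auto)
qed

section \<open>The spectrum of the dual loop\<close>

definition dual_loop :: "real mat" where
  "dual_loop = mat p p (\<lambda>(v, w). (if v = w then s v else 0) - (\<Sum>j<q. X v j * c j w))"

lemma dual_loop_carrier [simp]: "dual_loop \<in> carrier_mat p p"
  by (simp add: dual_loop_def)

text \<open>The columns of \<open>X\<close> sum to at most 1, so \<open>dual_loop\<close> has
  nonnegative column sums and the all-ones vector certifies its transpose directly.\<close>

lemma dual_loop_char_poly:
  assumes t: "t \<le> 0"
  shows "\<bar>poly (char_poly dual_loop) t\<bar> \<ge> \<bar>t\<bar> ^ p"
proof -
  have "\<bar>poly (char_poly (dual_loop\<^sup>T)) t\<bar> \<ge> \<bar>t\<bar> ^ p"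
  proof (rule abs_poly_char_poly_Z_mat[where v = "\<lambda>_. 1"])
    fix w v assume "w < p" "v < p" "w \<noteq> v"
    then show "dual_loop\<^sup>T $$ (w, v) \<le> 0"
      using X_nonneg c_nonneg by (auto simp: dual_loop_def intro!: sum_nonneg)
  next
    fix w assume w: "w < p"
    have "(\<Sum>v<p. dual_loop\<^sup>T $$ (w, v) * 1) = s w - (\<Sum>v<p. \<Sum>j<q. X v j * c j w)"
      using w by (simp add: dual_loop_def sum_subtractf)
    moreover have "(\<Sum>v<p. \<Sum>j<q. X v j * c j w) = (\<Sum>j<q. (\<Sum>v<p. X v j) * c j w)"
      by (subst sum.swap) (simp add: sum_distrib_right)
    moreover have "(\<Sum>j<q. (\<Sum>v<p. X v j) * c j w) \<le> (\<Sum>j<q. 1 * c j w)"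
      using w c_nonneg X_col_sum by (intro sum_mono mult_right_mono) auto
    ultimately show "(\<Sum>v<p. dual_loop\<^sup>T $$ (w, v) * 1) \<ge> 0" by (simp add: s_def)
  qed (use t in auto)
  then show ?thesis by (simp add: char_poly_transpose_mat[OF dual_loop_carrier])
qed

end

section \<open>Characteristic polynomials and roots\<close>

lemma poly_eq_prod_proots:
  fixes p :: "'a :: idom poly"
  assumes "p \<noteq> 0" "size (proots p) = degree p"
  shows "p = Polynomial.smult (lead_coeff p) (\<Prod>x\<in>#proots p. [:- x, 1:])"
  using assms
proof (induction "degree p" arbitrary: p)
  case 0
  then obtain a where "p = [:a:]" by (metis degree_eq_zeroE)
  then show ?case using 0 by simp
next
  case (Suc n)
  then obtain x where x: "x \<in># proots p" by (metis multiset_nonemptyE size_empty nat.distinct(1))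
  then have "poly p x = 0" using Suc.prems by simp
  then obtain r where r: "p = [:- x, 1:] * r" by (metis dvdE poly_eq_0_iff_dvd)
  have "r \<noteq> 0" using r Suc.prems by auto
  have pr: "proots p = {#x#} + proots r"
    unfolding r using \<open>r \<noteq> 0\<close> by (subst proots_mult) auto
  have deg: "degree p = Suc (degree r)"
    unfolding r using \<open>r \<noteq> 0\<close> by (subst degree_mult_eq) auto
  have "r = Polynomial.smult (lead_coeff r) (\<Prod>x\<in>#proots r. [:- x, 1:])"
    using Suc.prems Suc.hyps(2) pr deg \<open>r \<noteq> 0\<close> by (intro Suc.hyps(1)) auto
  moreover have "lead_coeff p = lead_coeff r"
    unfolding r lead_coeff_mult by simp
  ultimately have "p = [:- x, 1:] * Polynomial.smult (lead_coeff p) (\<Prod>x\<in>#proots r. [:- x, 1:])"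
    using r by metis
  also have "\<dots> = Polynomial.smult (lead_coeff p) (\<Prod>x\<in>#proots p. [:- x, 1:])"
    by (simp only: pr image_mset_union image_mset_single prod_mset.union prod_mset_singleton mult_smult_right)
  finally show ?case .
qed

lemma char_poly_eq_prod_list:
  fixes A :: "'a :: idom mat"
  assumes A: "A \<in> carrier_mat n n" and "mset es = proots (char_poly A)" "length es = n"
  shows "char_poly A = (\<Prod>a\<leftarrow>es. [:- a, 1:])"
proof -
  have "size (proots (char_poly A)) = degree (char_poly A)"
    using assms degree_monic_char_poly[OF A] by (metis size_mset)
  then have "char_poly A = (\<Prod>x\<in>#proots (char_poly A). [:- x, 1:])"
    using poly_eq_prod_proots[of "char_poly A"] degree_monic_char_poly[OF A] by fastforce
  also have "\<dots> = (\<Prod>a\<leftarrow>es. [:- a, 1:])"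
    unfolding assms(2)[symmetric] by (metis mset_map prod_mset_prod_list)
  finally show ?thesis .
qed

lemma char_poly_nonzero:
  fixes A :: "'a :: idom mat" shows "A \<in> carrier_mat n n \<Longrightarrow> char_poly A \<noteq> 0"
  using degree_monic_char_poly[of A n] by auto

section \<open>Traces and block determinants\<close>

lemma diag_sum_mult_commute:
  fixes A B :: "'a :: comm_semiring_0 mat"
  assumes "A \<in> carrier_mat n m" "B \<in> carrier_mat m n"
  shows "(\<Sum>i<n. (A * B) $$ (i, i)) = (\<Sum>j<m. (B * A) $$ (j, j))"
proof -
  have "(\<Sum>i<n. (A * B) $$ (i, i)) = (\<Sum>i<n. \<Sum>j<m. A $$ (i, j) * B $$ (j, i))"
    using assms by (intro sum.cong) (auto simp: scalar_prod_def lessThan_atLeast0)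
  also have "\<dots> = (\<Sum>j<m. \<Sum>i<n. B $$ (j, i) * A $$ (i, j))"
    by (subst sum.swap) (simp add: mult.commute)
  also have "\<dots> = (\<Sum>j<m. (B * A) $$ (j, j))"
    using assms by (intro sum.cong) (auto simp: scalar_prod_def lessThan_atLeast0)
  finally show ?thesis .
qed

text \<open>A Schur triangularisation has the roots on its diagonal, and the trace is invariant
  under similarity.\<close>

lemma sum_roots_eq_diag_sum:
  fixes A :: "real mat"
  assumes A: "A \<in> carrier_mat n n" and cp: "char_poly A = (\<Prod>a\<leftarrow>es. [:- a, 1:])"
  shows "sum_list es = (\<Sum>i<n. A $$ (i, i))"
proof -
  obtain B P Q where "schur_decomposition A es = (B, P, Q)" by (cases "schur_decomposition A es") auto
  from schur_decomposition[OF A cp this]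
  have wit: "similar_mat_wit A B P Q" and B: "diag_mat B = es" by auto
  note w = similar_mat_witD2[OF A wit]
  have "sum_list es = (\<Sum>i<n. B $$ (i, i))"
    unfolding B[symmetric] diag_mat_def using w by (simp add: interv_sum_list_conv_sum_set_nat lessThan_atLeast0)
  also have "B = Q * (P * B)"
    using w by (subst assoc_mult_mat[symmetric, of _ n n _ n _ n]) auto
  also have "(\<Sum>i<n. (Q * (P * B)) $$ (i, i)) = (\<Sum>i<n. (P * B * Q) $$ (i, i))"
    using w by (intro diag_sum_mult_commute) auto
  finally show ?thesis using w by simp
qed

lemma sum_proots_eq_diag_sum:
  fixes A :: "real mat"
  assumes A: "A \<in> carrier_mat n n" and sz: "size (proots (char_poly A)) = n"
  shows "(\<Sum>x\<in>#proots (char_poly A). x) = (\<Sum>i<n. A $$ (i, i))"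
proof -
  obtain es where es: "mset es = proots (char_poly A)" using ex_mset by blast
  then have "length es = n" using sz by (metis size_mset)
  from sum_roots_eq_diag_sum[OF A char_poly_eq_prod_list[OF A es this]] es
  show ?thesis by (metis multiset.map_ident sum_mset_sum_list)
qed

lemma char_poly_four_block_lower_left_zero:
  fixes A :: "'a :: idom mat"
  assumes A: "A \<in> carrier_mat n n" and B: "B \<in> carrier_mat n m" and D: "D \<in> carrier_mat m m"
  shows "char_poly (four_block_mat A B (0\<^sub>m m n) D) = char_poly A * char_poly D"
proof -
  have "char_poly_matrix (four_block_mat A B (0\<^sub>m m n) D)
      = four_block_mat (char_poly_matrix A) (map_mat (\<lambda>a. [:- a:]) B) (0\<^sub>m m n) (char_poly_matrix D)"
    unfolding char_poly_matrix_def by (rule eq_matI) (use A B D in \<open>auto simp: one_poly_def\<close>)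
  then show ?thesis
    unfolding char_poly_def using A B D
    by (simp only:) (rule det_four_block_mat_lower_left_zero[of _ n _ m], auto)
qed

text \<open>Sylvester's determinant identity: the block matrix \<open>[[1, Z], [U, 1]]\<close> is
  factored in two ways into the unit triangular \<open>?L\<close> and a block triangular
  matrix.\<close>

lemma det_one_minus_mult_commute:
  fixes U :: "'a :: idom mat"
  assumes U: "U \<in> carrier_mat n m" and Z: "Z \<in> carrier_mat m n"
  shows "det (1\<^sub>m n - U * Z) = det (1\<^sub>m m - Z * U)"
proof -
  let ?L = "four_block_mat (1\<^sub>m m) (0\<^sub>m m n) U (1\<^sub>m n)"
  have L: "?L \<in> carrier_mat (m + n) (m + n)" and dL: "det ?L = 1"
    using U by (auto simp: det_four_block_mat_upper_right_zero[of _ m _ n])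
  have 1: "?L * four_block_mat (1\<^sub>m m) Z (0\<^sub>m n m) (1\<^sub>m n - U * Z) = four_block_mat (1\<^sub>m m) Z U (1\<^sub>m n)"
    using U Z by (subst mult_four_block_mat[of _ m m _ n _ n _ _ m _ n]) (auto intro!: arg_cong2[of _ _ _ _ "four_block_mat _ _"] eq_matI)
  have 2: "four_block_mat (1\<^sub>m m - Z * U) Z (0\<^sub>m n m) (1\<^sub>m n) * ?L = four_block_mat (1\<^sub>m m) Z U (1\<^sub>m n)"
    using U Z by (subst mult_four_block_mat[of _ m m _ n _ n _ _ m _ n]) (auto intro!: eq_matI arg_cong[of _ _ "\<lambda>x. four_block_mat x _ _ _"])
  have "det (four_block_mat (1\<^sub>m m) Z (0\<^sub>m n m) (1\<^sub>m n - U * Z)) = det (1\<^sub>m m) * det (1\<^sub>m n - U * Z)"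
    by (rule det_four_block_mat_lower_left_zero) (use U Z in auto)
  then have "det (?L * four_block_mat (1\<^sub>m m) Z (0\<^sub>m n m) (1\<^sub>m n - U * Z)) = det (1\<^sub>m n - U * Z)"
    using U Z by (subst det_mult[OF L]) (auto simp: dL)
  moreover have "det (four_block_mat (1\<^sub>m m - Z * U) Z (0\<^sub>m n m) (1\<^sub>m n)) = det (1\<^sub>m m - Z * U) * det (1\<^sub>m n)"
    by (rule det_four_block_mat_lower_left_zero) (use U Z in auto)
  then have "det (four_block_mat (1\<^sub>m m - Z * U) Z (0\<^sub>m n m) (1\<^sub>m n) * ?L) = det (1\<^sub>m m - Z * U)"
    using U Z L by (subst det_mult[of _ "m + n"]) (auto simp: dL)
  ultimately show ?thesis unfolding 1 2 by simp
qed

lemma poly_char_poly_shift: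
  fixes A :: "'a :: field mat"
  assumes A: "A \<in> carrier_mat n n"
  shows "poly (char_poly (A + x \<cdot>\<^sub>m 1\<^sub>m n)) t = poly (char_poly A) (t - x)"
  using A by (subst char_poly_matrix[of _ n], simp, subst char_poly_matrix[of _ n], simp)
    (auto simp: char_matrix_def intro!: arg_cong[of _ _ det] eq_matI)

section \<open>The Laplacian spectrum of a split graph\<close>

lemma sum_lessThan_add:
  fixes f :: "nat \<Rightarrow> 'a :: comm_monoid_add"
  shows "(\<Sum>l<m + n. f l) = (\<Sum>l<m. f l) + (\<Sum>l<n. f (m + l))"
  by (induction n) (auto simp: add.assoc)

lemma poly_char_poly_minus:
  fixes A :: "'a :: field mat"
  assumes A: "A \<in> carrier_mat n n" and "poly (char_poly (x \<cdot>\<^sub>m 1\<^sub>m n - A)) t = 0"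
  shows "poly (char_poly A) (x - t) = 0"
proof -
  have "x \<cdot>\<^sub>m 1\<^sub>m n - A \<in> carrier_mat n n" by (rule minus_carrier_mat[OF A])
  then have "det (- char_matrix (x \<cdot>\<^sub>m 1\<^sub>m n - A) t) = 0"
    using assms(2) by (simp only: char_poly_matrix)
  moreover have "- char_matrix (x \<cdot>\<^sub>m 1\<^sub>m n - A) t = char_matrix A (x - t)"
    unfolding char_matrix_def by (rule eq_matI) (use A in auto)
  ultimately have "det (- char_matrix A (x - t)) = 0"
    using det_0_negate[of "char_matrix A (x - t)" n] A by simp
  then show ?thesis by (simp only: char_poly_matrix[OF A])
qed

context bipartite_weights
begin

lemma sum_b_col: "v < p \<Longrightarrow> (\<Sum>i<q. b i v) = real q - s v"
  by (simp add: s_def c_def sum_subtractf)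

text \<open>The Laplacian of the weighted graph in which \<open>Q\<close> is a clique,
  \<open>P\<close> is independent and the crossing edges have weights \<open>b\<close>; the weighted
  degree of \<open>v\<close> in \<open>P\<close> is \<open>q - s v\<close>.\<close>

definition split_laplacian :: "real mat" where
  "split_laplacian = four_block_mat
     (mat q q (\<lambda>(i, j). (if i = j then real q + d i else 0) - 1)) (mat q p (\<lambda>(i, v). - b i v))
     (mat p q (\<lambda>(v, i). - b i v)) (mat p p (\<lambda>(v, w). if v = w then real q - s v else 0))"

lemma split_laplacian_carrier [simp]: "split_laplacian \<in> carrier_mat (q + p) (q + p)"
  by (simp add: split_laplacian_def)

text \<open>The conjugate of \<open>split_laplacian\<close> by \<open>diag (1, -1)\<close>.\<close>

definition signed_laplacian :: "real mat" where
  "signed_laplacian = four_block_mat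
     (mat q q (\<lambda>(i, j). (if i = j then real q + d i else 0) - 1)) (mat q p (\<lambda>(i, v). b i v))
     (mat p q (\<lambda>(v, i). b i v)) (mat p p (\<lambda>(v, w). if v = w then real q - s v else 0))"

lemma signed_laplacian_carrier [simp]: "signed_laplacian \<in> carrier_mat (q + p) (q + p)"
  by (simp add: signed_laplacian_def)

lemma char_poly_signed_laplacian: "char_poly signed_laplacian = char_poly split_laplacian"
proof -
  let ?S = "four_block_mat (1\<^sub>m q) (0\<^sub>m q p) (0\<^sub>m p q) (- 1\<^sub>m p) :: real mat"
  have S: "?S \<in> carrier_mat (q + p) (q + p)" by simp
  have SS: "?S * ?S = 1\<^sub>m (q + p)"
    by (subst mult_four_block_mat[of _ q q _ p _ p _ _ q _ p]) (auto intro!: eq_matI)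
  have "?S * split_laplacian = four_block_mat
     (mat q q (\<lambda>(i, j). (if i = j then real q + d i else 0) - 1)) (mat q p (\<lambda>(i, v). - b i v))
     (mat p q (\<lambda>(v, i). b i v)) (mat p p (\<lambda>(v, w). if v = w then - (real q - s v) else 0))"
    unfolding split_laplacian_def
    by (subst mult_four_block_mat[of _ q q _ p _ p _ _ q _ p])
      (auto simp: uminus_mult_left_mat intro!: arg_cong2[of _ _ _ _ "four_block_mat _ _"] eq_matI)
  also have "\<dots> * ?S = signed_laplacian"
    unfolding signed_laplacian_def
    by (subst mult_four_block_mat[of _ q q _ p _ p _ _ q _ p])
      (auto simp: uminus_mult_right_mat intro!: arg_cong2[of _ _ _ _ "\<lambda>x y. four_block_mat _ x _ y"] eq_matI)
  finally have "?S * split_laplacian * ?S = signed_laplacian" .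
  then have "similar_mat signed_laplacian split_laplacian"
    using S SS by (intro similar_matI[of _ _ ?S ?S "q + p"]) auto
  then show ?thesis by (rule char_poly_similar)
qed

text \<open>Subtracting \<open>q\<close> times the identity leaves the block matrix
  \<open>[[D, -C], [B^T, -S]]\<close> of the Riccati equation.\<close>

definition riccati_mat :: "real mat" where
  "riccati_mat = four_block_mat
     (mat q q (\<lambda>(i, j). if i = j then real q + d i else 0)) (mat q p (\<lambda>(i, v). - c i v))
     (mat p q (\<lambda>(v, i). b i v)) (mat p p (\<lambda>(v, w). if v = w then real q - s v else 0))"

lemma riccati_mat_carrier [simp]: "riccati_mat \<in> carrier_mat (q + p) (q + p)"
  by (simp add: riccati_mat_def)

text \<open>
  \<open>riccati_mat\<close> is \<open>signed_laplacian\<close> plus \<open>u z\<^sup>T\<close>, where \<open>u\<close> is the indicator of \<open>Q\<close> and \<open>z = (1, -1)\<close>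
  is a left null vector of \<open>signed_laplacian\<close> with \<open>z \<bullet> u = q\<close>.
\<close>

lemma poly_char_poly_riccati_mat:
  assumes y: "y \<noteq> 0"
  shows "poly (char_poly riccati_mat) y * y = poly (char_poly split_laplacian) y * (y - q)"
proof -
  let ?n = "q + p"
  define V where "V = - char_matrix signed_laplacian y"
  \<comment> \<open>\<open>V\<close> is \<open>y I - signed_laplacian\<close>, and
    \<open>Z V = y Z\<close>. Because of the factor \<open>1 / y\<close>, multiplying
    \<open>V\<close> by \<open>1 - U Z\<close> subtracts exactly the rank-one update, and the
    determinant of \<open>1 - U Z\<close> is \<open>1 - q / y\<close>.\<close>
  define U where "U = mat ?n 1 (\<lambda>(k, _). if k < q then 1 / y else 0)"
  define Z where "Z = mat 1 ?n (\<lambda>(_, k). if k < q then 1 else - 1 :: real)"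
  have V: "V \<in> carrier_mat ?n ?n" and U: "U \<in> carrier_mat ?n 1" and Z: "Z \<in> carrier_mat 1 ?n"
    by (auto simp: V_def U_def Z_def)
  have V_entry: "V $$ (k, l) = (if k = l then y else 0) - signed_laplacian $$ (k, l)"
    if "k < ?n" "l < ?n" for k l
    using that carrier_matD[OF signed_laplacian_carrier] by (auto simp: V_def char_matrix_def)
  have ZV: "Z * V = y \<cdot>\<^sub>m Z"
  proof (rule eq_matI)
    fix k l assume "k < dim_row (y \<cdot>\<^sub>m Z)" "l < dim_col (y \<cdot>\<^sub>m Z)"
    then have k: "k = 0" and l: "l < ?n" using Z by auto
    have "(Z * V) $$ (k, l) = (\<Sum>i<?n. Z $$ (0, i) * V $$ (i, l))"
      using V Z l k by (simp add: scalar_prod_def lessThan_atLeast0)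
    also have "\<dots> = (\<Sum>i<q. V $$ (i, l)) - (\<Sum>v<p. V $$ (q + v, l))"
      unfolding sum_lessThan_add by (simp add: Z_def sum_negf)
    also have "\<dots> = y * Z $$ (k, l)"
    proof (cases "l < q")
      case True
      have "(\<Sum>i<q. V $$ (i, l)) = (\<Sum>i<q. (if i = l then y - (real q + d l) else 0) + 1)"
        using True by (intro sum.cong refl) (auto simp: V_entry signed_laplacian_def)
      moreover have "(\<Sum>v<p. V $$ (q + v, l)) = (\<Sum>v<p. - b l v)"
        using True by (intro sum.cong refl) (auto simp: V_entry signed_laplacian_def)
      ultimately show ?thesis
        using True k by (simp add: sum.distrib sum_negf d_def Z_def)
    next
      case False
      define w where "w = l - q"
      have w: "w < p" "l = q + w" using False l by (auto simp: w_def)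
      have "(\<Sum>i<q. V $$ (i, l)) = (\<Sum>i<q. - b i w)"
        using w by (intro sum.cong refl) (auto simp: V_entry signed_laplacian_def)
      moreover have "(\<Sum>v<p. V $$ (q + v, l)) = (\<Sum>v<p. if v = w then y - (real q - s w) else 0)"
        using w by (intro sum.cong refl) (auto simp: V_entry signed_laplacian_def)
      ultimately show ?thesis
        using w k by (simp add: sum_negf sum_b_col Z_def)
    qed
    finally show "(Z * V) $$ (k, l) = (y \<cdot>\<^sub>m Z) $$ (k, l)" using Z k l by simp
  qed (use V Z in auto)
  have "- char_matrix riccati_mat y = (1\<^sub>m ?n - U * Z) * V"
  proof -
    have "(1\<^sub>m ?n - U * Z) * V = V - U * (Z * V)"
      using U V Z by (simp add: minus_mult_distrib_mat[of _ ?n ?n] assoc_mult_mat[of _ ?n 1 _ ?n _ ?n])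
    also have "\<dots> = - char_matrix riccati_mat y"
      unfolding ZV
    proof (rule eq_matI)
      fix k l assume "k < dim_row (- char_matrix riccati_mat y)" "l < dim_col (- char_matrix riccati_mat y)"
      then have kl: "k < ?n" "l < ?n"
        using carrier_matD[OF riccati_mat_carrier] by (auto simp: char_matrix_def)
      have "(U * (y \<cdot>\<^sub>m Z)) $$ (k, l) = (if k < q then if l < q then 1 else - 1 else 0)"
        using y kl by (auto simp: U_def Z_def scalar_prod_def)
      then show "(V - U * (y \<cdot>\<^sub>m Z)) $$ (k, l) = (- char_matrix riccati_mat y) $$ (k, l)"
        using kl V U Z carrier_matD[OF riccati_mat_carrier]
        by (auto simp: V_entry char_matrix_def signed_laplacian_def riccati_mat_def c_def)
    qed (use U V Z carrier_matD[OF riccati_mat_carrier] in \<open>auto simp: char_matrix_def\<close>)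
    finally show ?thesis by simp
  qed
  then have "poly (char_poly riccati_mat) y = det ((1\<^sub>m ?n - U * Z) * V)"
    by (simp only: char_poly_matrix[OF riccati_mat_carrier])
  also have "\<dots> = det (1\<^sub>m ?n - U * Z) * det V"
    by (rule det_mult[of _ ?n]) (use U V Z in auto)
  also have "det (1\<^sub>m ?n - U * Z) = det (1\<^sub>m 1 - Z * U)"
    by (rule det_one_minus_mult_commute[OF U Z])
  also have "\<dots> = 1 - (\<Sum>k<?n. Z $$ (0, k) * U $$ (k, 0))"
    using U Z by (subst det_single) (auto simp: scalar_prod_def lessThan_atLeast0)
  also have "\<dots> = 1 - q / y"
    unfolding sum_lessThan_add by (simp add: U_def Z_def)
  also have "det V = poly (char_poly split_laplacian) y"
    unfolding V_def char_poly_matrix[OF signed_laplacian_carrier, symmetric] char_poly_signed_laplacian ..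
  finally show ?thesis using y by (simp add: field_simps)
qed

lemma char_poly_riccati_mat_times:
  "char_poly riccati_mat * [:0, 1:] = char_poly split_laplacian * [:- real q, 1:]"
proof -
  \<comment> \<open>The pointwise identity excludes \<open>y = 0\<close>; an extra factor vanishing
    there makes both sides agree everywhere and is cancelled afterwards.\<close>
  have "poly ([:0, 1:] * (char_poly riccati_mat * [:0, 1:])) y
      = poly ([:0, 1:] * (char_poly split_laplacian * [:- real q, 1:])) y" for y
    using arg_cong[OF poly_char_poly_riccati_mat[of y], of "(*) y"]
    by (cases "y = 0") (simp_all add: algebra_simps)
  then have "[:0, 1:] * (char_poly riccati_mat * [:0, 1:])
      = [:0, 1:] * (char_poly split_laplacian * [:- real q, 1:])"
    by (simp only: poly_eq_poly_eq_iff[symmetric] fun_eq_iff) simp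
  then show ?thesis by (subst (asm) mult_left_cancel) auto
qed

text \<open>Conjugation by the unit triangular matrix \<open>[[1, 0], [X, 1]]\<close> gives a block
  upper triangular matrix: the vanishing of the lower left block is the Riccati equation
  \<open>X_eq\<close>, the two copies of \<open>q X\<close> cancelling.\<close>

lemma char_poly_riccati_mat:
  "char_poly riccati_mat = char_poly (closed_loop (\<lambda>i. real q + d i) X) * char_poly (real q \<cdot>\<^sub>m 1\<^sub>m p - dual_loop)"
proof -
  let ?n = "q + p"
  define Y where "Y = mat p q (\<lambda>(v, i). X v i)"
  define N where "N = closed_loop (\<lambda>i. real q + d i) X"
  define R where "R = real q \<cdot>\<^sub>m 1\<^sub>m p - dual_loop"
  define C where "C = mat q p (\<lambda>(i, v). - c i v)"
  define D where "D = mat q q (\<lambda>(i, j). if i = j then real q + d i else 0)"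
  define E where "E = mat p p (\<lambda>(v, w). if v = w then real q - s v else 0)"
  define F where "F = mat p q (\<lambda>(v, i). b i v)"
  have [simp]: "Y \<in> carrier_mat p q" "N \<in> carrier_mat q q" "R \<in> carrier_mat p p" "C \<in> carrier_mat q p"
    "D \<in> carrier_mat q q" "E \<in> carrier_mat p p" "F \<in> carrier_mat p q"
    using minus_carrier_mat[OF dual_loop_carrier]
    by (auto simp: Y_def N_def R_def C_def D_def E_def F_def)
  let ?S = "four_block_mat (1\<^sub>m q) (0\<^sub>m q p) Y (1\<^sub>m p)"
  let ?S' = "four_block_mat (1\<^sub>m q) (0\<^sub>m q p) (- Y) (1\<^sub>m p)"
  let ?T = "four_block_mat N C (0\<^sub>m p q) R"
  have S: "?S \<in> carrier_mat ?n ?n" "?S' \<in> carrier_mat ?n ?n" "?T \<in> carrier_mat ?n ?n" by simp_all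
  have cancel: "Y + - Y = 0\<^sub>m p q" "- Y + Y = 0\<^sub>m p q" "1\<^sub>m q + - 0\<^sub>m q q = (1\<^sub>m q :: real mat)"
    and [simp]: "dim_row Y = p" "dim_col Y = q" "dim_row C = q" "dim_col C = p" "dim_row D = q" "dim_col D = q"
      "dim_row E = p" "dim_col E = p" "dim_row F = p" "dim_col F = q"
      "dim_row N = q" "dim_col N = q" "dim_row R = p" "dim_col R = p"
    by (auto intro!: eq_matI simp: Y_def C_def D_def E_def F_def N_def R_def closed_loop_def dual_loop_def)
  have SS': "?S * ?S' = 1\<^sub>m ?n"
    by (subst mult_four_block_mat[of _ q q _ p _ p _ _ q _ p]) (simp_all add: cancel)
  have S'S: "?S' * ?S = 1\<^sub>m ?n"
    by (subst mult_four_block_mat[of _ q q _ p _ p _ _ q _ p]) (simp_all add: cancel)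
  have NE: "D + C * Y = N"
  proof (rule eq_matI)
    fix i j assume "i < dim_row N" "j < dim_col N"
    then have ij: "i < q" "j < q" by (auto simp: N_def closed_loop_def)
    then show "(D + C * Y) $$ (i, j) = N $$ (i, j)"
      by (simp add: D_def C_def Y_def N_def closed_loop_def scalar_prod_def lessThan_atLeast0 sum_negf)
  qed (auto simp: N_def closed_loop_def D_def C_def Y_def)
  have RE: "Y * C + R = E"
  proof (rule eq_matI)
    fix v w assume "v < dim_row E" "w < dim_col E"
    then have vw: "v < p" "w < p" by (auto simp: E_def)
    then show "(Y * C + R) $$ (v, w) = E $$ (v, w)"
      by (simp add: E_def C_def Y_def R_def dual_loop_def scalar_prod_def lessThan_atLeast0 sum_negf)
  qed (auto simp: E_def R_def Y_def C_def dual_loop_def)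
  have YE: "F + E * Y = Y * N"
  proof (rule eq_matI)
    fix v i assume "v < dim_row (Y * N)" "i < dim_col (Y * N)"
    then have vi: "v < p" "i < q" by (auto simp: Y_def N_def closed_loop_def)
    have "(E * Y) $$ (v, i) = (\<Sum>w<p. (if v = w then real q - s v else 0) * X w i)"
      using vi by (simp add: E_def Y_def scalar_prod_def lessThan_atLeast0)
    moreover have "\<dots> = (\<Sum>w<p. if w = v then (real q - s v) * X v i else 0)"
      by (intro sum.cong refl) auto
    moreover have "(Y * N) $$ (v, i) = (\<Sum>j<q. X v j * N $$ (j, i))"
      using vi by (simp add: Y_def N_def closed_loop_def scalar_prod_def lessThan_atLeast0)
    moreover have "\<dots> = (\<Sum>j<q. (if j = i then X v i * (real q + d i) else 0) - (\<Sum>w<p. X v j * c j w * X w i))"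
      using vi by (intro sum.cong refl) (auto simp: N_def closed_loop_entry sum_distrib_left right_diff_distrib mult.assoc)
    ultimately show "(F + E * Y) $$ (v, i) = (Y * N) $$ (v, i)"
      using vi X_eq[OF vi(2) vi(1)] by (simp add: F_def Y_def E_def sum_subtractf algebra_simps)
  qed (auto simp: Y_def N_def F_def E_def closed_loop_def)
  have H: "riccati_mat = four_block_mat D C F E"
    by (simp add: riccati_mat_def D_def C_def E_def F_def)
  have "riccati_mat * ?S = four_block_mat N C (Y * N) E"
    unfolding H by (subst mult_four_block_mat[of _ q q _ p _ p _ _ q _ p]) (simp_all add: NE YE)
  also have "\<dots> = ?S * ?T"
    by (subst mult_four_block_mat[of _ q q _ p _ p _ _ q _ p]) (simp_all add: RE right_add_zero_mat[OF mult_carrier_mat[of Y p q N q]])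
  finally have HS: "riccati_mat * ?S = ?S * ?T" .
  have "riccati_mat = riccati_mat * (?S * ?S')" unfolding SS' by (rule right_mult_one_mat[OF riccati_mat_carrier, symmetric])
  also have "\<dots> = ?S * ?T * ?S'"
    using S by (subst assoc_mult_mat[symmetric, of _ ?n ?n _ ?n _ ?n]) (auto simp: HS)
  finally have eq: "riccati_mat = ?S * ?T * ?S'" .
  have "similar_mat riccati_mat ?T"
    by (rule similar_matI[OF _ SS' S'S eq]) (use S riccati_mat_carrier in simp)
  then have "char_poly riccati_mat = char_poly ?T" by (rule char_poly_similar)
  also have "\<dots> = char_poly N * char_poly R" by (rule char_poly_four_block_lower_left_zero) auto
  finally show ?thesis unfolding N_def R_def .
qed

lemma real_roots_ge:
  fixes A :: "real mat"
  assumes A: "A \<in> carrier_mat n n" and "\<And>t. t < 0 \<Longrightarrow> \<bar>poly (char_poly A) t\<bar> \<ge> \<bar>t\<bar> ^ n"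
    and "x \<in># proots (char_poly A)"
  shows "x \<ge> 0"
proof (rule ccontr)
  assume "\<not> x \<ge> 0"
  then have "\<bar>x\<bar> ^ n \<le> \<bar>poly (char_poly A) x\<bar>" "\<bar>x\<bar> ^ n > 0" using assms(2) by auto
  moreover have "poly (char_poly A) x = 0" using assms(3) char_poly_nonzero[OF A] by simp
  ultimately show False by simp
qed

text \<open>After exchanging one 0 for one \<open>q\<close>, neither of which affects the sum, the
  spectrum splits into the roots of \<open>N\<close>, all at least \<open>q\<close>, and those of
  \<open>R\<close>, all at most \<open>q\<close>. The positive parts thus add up to the trace of
  \<open>N\<close> minus \<open>q^2\<close>, which is the sum of the \<open>d i\<close> minus the
  nonnegative trace of \<open>C X\<close>.\<close>

theorem sum_positive_part_split_laplacian:
  "(\<Sum>x\<in>#proots (char_poly split_laplacian). max (x - real q) 0) \<le> (\<Sum>i<q. d i)"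
proof -
  define N where "N = closed_loop (\<lambda>i. real q + d i) X"
  define R where "R = real q \<cdot>\<^sub>m 1\<^sub>m p - dual_loop"
  have N: "N \<in> carrier_mat q q" and R: "R \<in> carrier_mat p p"
    using minus_carrier_mat[OF dual_loop_carrier] by (auto simp: N_def R_def)
  have sym: "split_laplacian\<^sup>T = split_laplacian"
    unfolding split_laplacian_def by (rule eq_matI) auto
  have nz: "char_poly split_laplacian \<noteq> 0" "char_poly N \<noteq> 0" "char_poly R \<noteq> 0"
    using char_poly_nonzero N R split_laplacian_carrier by blast+
  have "proots (char_poly N * char_poly R * [:0, 1:]) = proots (char_poly split_laplacian * [:- real q, 1:])"
    unfolding N_def R_def char_poly_riccati_mat[symmetric] char_poly_riccati_mat_times ..
  then have roots: "proots (char_poly N) + proots (char_poly R) + {#0#} = proots (char_poly split_laplacian) + {#real q#}"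
    using nz proots_mult[of "char_poly N * char_poly R" "[:0, 1:]"] proots_mult[of "char_poly N" "char_poly R"]
      proots_mult[of "char_poly split_laplacian" "[:- real q, 1:]"]
    by (simp del: mult_pCons_right)
  have "size (proots (char_poly split_laplacian)) = q + p"
    by (rule size_proots_symmetric[OF split_laplacian_carrier sym])
  then have "size (proots (char_poly N)) + size (proots (char_poly R)) = q + p"
    using arg_cong[OF roots, of size] by simp
  moreover have "size (proots (char_poly N)) \<le> q" "size (proots (char_poly R)) \<le> p"
    using size_proots_le[of "char_poly N"] size_proots_le[of "char_poly R"] degree_monic_char_poly N R by auto
  \<comment> \<open>\<open>N\<close> need not be symmetric, but counting shows that its roots are
    all real: the symmetric \<open>split_laplacian\<close> has \<open>q + p\<close> real roots, and
    \<open>N\<close> and \<open>R\<close> provide at most \<open>q\<close> and \<open>p\<close>.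
    This makes the trace formula applicable to \<open>N\<close>.\<close>
  ultimately have sN: "size (proots (char_poly N)) = q" by simp
  have N_shift: "N = closed_loop d X + real q \<cdot>\<^sub>m 1\<^sub>m q"
    unfolding N_def closed_loop_def by (rule eq_matI) auto
  have N_ge: "x \<ge> real q" if "x \<in># proots (char_poly N)" for x
  proof -
    have "x - real q \<in># proots (char_poly (closed_loop d X))"
      using that nz char_poly_nonzero[OF closed_loop_carrier]
      unfolding N_shift by (simp add: poly_char_poly_shift[OF closed_loop_carrier])
    from real_roots_ge[OF closed_loop_carrier _ this] closed_loop_char_poly show ?thesis by fastforce
  qed
  have R_le: "x \<le> real q" if "x \<in># proots (char_poly R)" for x
  proof -
    have "poly (char_poly R) x = 0" using that nz by simp
    then have "poly (char_poly dual_loop) (real q - x) = 0"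
      by (metis R_def poly_char_poly_minus dual_loop_carrier)
    then have "real q - x \<in># proots (char_poly dual_loop)"
      using char_poly_nonzero[OF dual_loop_carrier] by simp
    from real_roots_ge[OF dual_loop_carrier _ this] dual_loop_char_poly show ?thesis by fastforce
  qed
  have "(\<Sum>x\<in>#proots (char_poly split_laplacian). max (x - real q) 0)
      = (\<Sum>x\<in>#proots (char_poly split_laplacian) + {#real q#}. max (x - real q) 0)"
    by simp
  also have "\<dots> = (\<Sum>x\<in>#proots (char_poly N). max (x - real q) 0) + (\<Sum>x\<in>#proots (char_poly R). max (x - real q) 0)"
    unfolding roots[symmetric] by simp
  also have "(\<Sum>x\<in>#proots (char_poly N). max (x - real q) 0) = (\<Sum>x\<in>#proots (char_poly N). x + - real q)"
    using N_ge by (intro arg_cong[of _ _ sum_mset] image_mset_cong) auto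
  also have "\<dots> = (\<Sum>i<q. N $$ (i, i)) - real q * real q"
    unfolding sum_mset.distrib using sum_proots_eq_diag_sum[OF N sN] sN by simp
  also have "(\<Sum>x\<in>#proots (char_poly R). max (x - real q) 0) = (\<Sum>x\<in>#proots (char_poly R). 0)"
    using R_le by (intro arg_cong[of _ _ sum_mset] image_mset_cong) auto
  also have "(\<Sum>i<q. N $$ (i, i)) = (\<Sum>i<q. real q + d i - (\<Sum>w<p. c i w * X w i))"
    by (intro sum.cong refl) (simp add: N_def closed_loop_entry)
  finally have "(\<Sum>x\<in>#proots (char_poly split_laplacian). max (x - real q) 0)
      = (\<Sum>i<q. d i) - (\<Sum>i<q. \<Sum>w<p. c i w * X w i)"
    by (simp add: sum_subtractf sum.distrib)
  moreover have "(\<Sum>i<q. \<Sum>w<p. c i w * X w i) \<ge> 0"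
    using c_nonneg X_nonneg by (intro sum_nonneg mult_nonneg_nonneg) auto
  ultimately show ?thesis by simp
qed

end

section \<open>The spectral theorem and the variational principle\<close>

text \<open>The reflection along \<open>w = v - e_0\<close> interchanges the unit vector
  \<open>v\<close> and the first basis vector \<open>e_0\<close>; here
  \<open>|w|^2 = 2 - 2 v_0\<close>. If \<open>v = e_0\<close>, the identity serves.\<close>

lemma householder:
  fixes v :: "real vec"
  assumes v: "v \<in> carrier_vec n" "v \<bullet> v = 1"
  obtains H where "H \<in> carrier_mat n n" "H\<^sup>T = H" "H * H = 1\<^sub>m n" "col H 0 = v"
proof (cases "v = unit_vec n 0")
  case True
  have "0 < n" using v by (cases n) (auto simp: scalar_prod_def)
  then show ?thesis using True by (intro that[of "1\<^sub>m n"]) auto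
next
  case False
  have n: "0 < n" using v by (cases n) (auto simp: scalar_prod_def)
  define w where "w i = v $ i - (if i = 0 then 1 else 0)" for i
  define W where "W = (\<Sum>i<n. w i * w i)"
  define H where "H = mat n n (\<lambda>(i, j). (if i = j then 1 else 0) - 2 / W * (w i * w j))"
  have vv: "(\<Sum>i<n. v $ i * v $ i) = 1" using v by (simp add: scalar_prod_def lessThan_atLeast0)
  have "W = (\<Sum>i<n. v $ i * v $ i + (if i = 0 then 1 - 2 * v $ 0 else 0))"
    unfolding W_def by (intro sum.cong refl) (auto simp: w_def algebra_simps)
  then have W: "W = 2 - 2 * v $ 0"
    using n vv by (simp add: sum.distrib)
  have "W \<noteq> 0"
  proof
    assume "W = 0"
    then have "\<forall>i<n. w i * w i = 0" unfolding W_def by (subst (asm) sum_nonneg_eq_0_iff) auto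
    then have "v = unit_vec n 0" using v by (intro eq_vecI) (auto simp: w_def unit_vec_def split: if_splits)
    then show False using False by simp
  qed
  have "H * H = 1\<^sub>m n"
  proof (rule eq_matI)
    fix i j assume "i < dim_row (1\<^sub>m n :: real mat)" "j < dim_col (1\<^sub>m n :: real mat)"
    then have ij: "i < n" "j < n" by auto
    have "(H * H) $$ (i, j) = (\<Sum>k<n. ((if i = k then 1 else 0) - 2 / W * (w i * w k)) * ((if k = j then 1 else 0) - 2 / W * (w k * w j)))"
      using ij by (simp add: H_def scalar_prod_def lessThan_atLeast0)
    also have "\<dots> = (\<Sum>k<n. (if k = i then (if i = j then 1 else 0) - 2 / W * (w i * w j) else 0)
        - (if k = j then 2 / W * (w i * w j) else 0) + (2 / W)\<^sup>2 * (w i * w j) * (w k * w k))"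
      by (intro sum.cong refl) (auto simp: algebra_simps power2_eq_square)
    also have "\<dots> = (if i = j then 1 else 0) - 2 * (2 / W * (w i * w j)) + (2 / W)\<^sup>2 * (w i * w j) * W"
      using ij by (simp add: sum.distrib sum_subtractf sum_distrib_left[symmetric] W_def)
    also have "\<dots> = (1\<^sub>m n) $$ (i, j)"
      using ij \<open>W \<noteq> 0\<close> by (simp add: power2_eq_square field_simps)
    finally show "(H * H) $$ (i, j) = 1\<^sub>m n $$ (i, j)" .
  qed (auto simp: H_def)
  moreover have "H\<^sup>T = H" unfolding H_def by (rule eq_matI) auto
  moreover have "col H 0 = v"
  proof (rule eq_vecI)
    fix i assume "i < dim_vec v"
    then have i: "i < n" using v by simp
    have "2 / W * w 0 = - 1" using W \<open>W \<noteq> 0\<close> by (simp add: w_def field_simps)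
    then have "2 / W * (w i * w 0) = - w i" by (metis mult.assoc mult.commute mult_minus1_right)
    then show "col H 0 $ i = v $ i" using i n by (simp add: H_def w_def)
  qed (use v in \<open>simp add: H_def\<close>)
  ultimately show ?thesis by (intro that[of H]) (auto simp: H_def)
qed

lemma char_poly_singleton: "char_poly (mat 1 1 (\<lambda>_. e)) = [:- e :: 'a :: comm_ring_1, 1:]"
proof -
  have "upper_triangular (mat 1 1 (\<lambda>_. e))" by auto
  then show ?thesis by (subst char_poly_upper_triangular[of _ 1]) (auto simp: diag_mat_def)
qed

definition list_diag_mat :: "'a :: zero list \<Rightarrow> 'a mat" where
  "list_diag_mat es = mat (length es) (length es) (\<lambda>(i, j). if i = j then es ! i else 0)"

lemma list_diag_mat_carrier [simp]: "length es = n \<Longrightarrow> list_diag_mat es \<in> carrier_mat n n"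
  by (simp add: list_diag_mat_def)

lemma list_diag_mat_Cons:
  "list_diag_mat (e # es) = four_block_mat (mat 1 1 (\<lambda>_. e)) (0\<^sub>m 1 (length es)) (0\<^sub>m (length es) 1) (list_diag_mat es)"
  unfolding list_diag_mat_def by (rule eq_matI) (auto simp: nth_Cons')

text \<open>Deflation by induction on the list: a reflection with a unit eigenvector as first column
  conjugates \<open>A\<close> to a symmetric matrix that splits off the 1 by 1 block
  \<open>e\<close>. The order of \<open>es\<close> is arbitrary, so it can be the sorted list of
  eigenvalues.\<close>

theorem symmetric_mat_spectral:
  fixes A :: "real mat"
  assumes "A \<in> carrier_mat n n" "A\<^sup>T = A" "char_poly A = (\<Prod>a\<leftarrow>es. [:- a, 1:])"
  shows "\<exists>U \<in> carrier_mat n n. U\<^sup>T * U = 1\<^sub>m n \<and> A = U * list_diag_mat es * U\<^sup>T"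
  using assms
proof (induction es arbitrary: n A)
  case Nil
  then have "n = 0" using degree_monic_char_poly[of A n] by simp
  then show ?case using Nil by (intro bexI[of _ "1\<^sub>m 0"]) (auto simp: list_diag_mat_def)
next
  case (Cons e es)
  note A = Cons.prems(1) and sym = Cons.prems(2) and cp = Cons.prems(3)
  define m where "m = length es"
  have n: "n = 1 + m"
    using degree_monic_char_poly[OF A] degree_linear_factors[of uminus "e # es"] unfolding cp m_def by simp
  have "poly (char_poly A) e = 0" unfolding cp by simp
  then have "eigenvalue A e" using eigenvalue_root_char_poly[OF A] by simp
  then obtain z where z: "z \<in> carrier_vec n" "z \<noteq> 0\<^sub>v n" "A *\<^sub>v z = e \<cdot>\<^sub>v z"
    using A by (auto simp: eigenvalue_def eigenvector_def)
  have zz: "z \<bullet> z > 0"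
  proof -
    obtain i where i: "i < n" "z $ i \<noteq> 0" using z by (metis carrier_vecD eq_vecI index_zero_vec)
    have "0 < (\<Sum>i<n. z $ i * z $ i)"
      by (rule sum_pos2[of _ i]) (use i in \<open>auto simp: zero_less_mult_iff neq_iff\<close>)
    then show ?thesis using z by (simp add: scalar_prod_def lessThan_atLeast0)
  qed
  define v where "v = (1 / sqrt (z \<bullet> z)) \<cdot>\<^sub>v z"
  have v: "v \<in> carrier_vec n" "v \<bullet> v = 1"
    using z zz by (auto simp: v_def)
  have Av: "A *\<^sub>v v = e \<cdot>\<^sub>v v"
    using A z by (simp add: v_def mult_mat_vec smult_smult_assoc mult.commute)
  obtain H where H: "H \<in> carrier_mat n n" "H\<^sup>T = H" "H * H = 1\<^sub>m n" "col H 0 = v"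
    using householder[OF v] by blast
  define B where "B = H * A * H"
  have B: "B \<in> carrier_mat n n" using A H by (auto simp: B_def)
  have Bsym: "B\<^sup>T = B"
    unfolding B_def using A H sym by (simp add: transpose_mult[of _ n n _ n] assoc_mult_mat[of _ n n _ n _ n])
  have "H * B * H = (H * H) * A * (H * H)"
    unfolding B_def using A H(1) by (simp add: assoc_mult_mat[of _ n n _ n _ n])
  then have HBH: "A = H * B * H" using A H by simp
  have "col B 0 = (H * A) *\<^sub>v v"
    unfolding B_def using A H n by (subst col_mult2[of _ n n _ n]) auto
  also have "\<dots> = H *\<^sub>v (e \<cdot>\<^sub>v v)"
    using A H v by (subst assoc_mult_mat_vec[of _ n n _ n]) (auto simp: Av)
  also have "\<dots> = e \<cdot>\<^sub>v (H *\<^sub>v col H 0)"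
    using H v by (simp add: mult_mat_vec[of _ n n])
  also have "H *\<^sub>v col H 0 = col (H * H) 0"
    using H n by (subst col_mult2[of _ n n _ n]) auto
  \<comment> \<open>\<open>v\<close> is column 0 of \<open>H\<close> and \<open>H * H = 1\<close>,
    so \<open>H v\<close> is the first unit vector.\<close>
  finally have colB: "col B 0 = e \<cdot>\<^sub>v unit_vec n 0" using H n by simp
  have B0: "B $$ (i, 0) = (if i = 0 then e else 0)" if "i < n" for i
    using arg_cong[OF colB, of "\<lambda>x. x $ i"] that B n by (simp add: unit_vec_def)
  have B0': "B $$ (0, j) = (if j = 0 then e else 0)" if "j < n" for j
    using B0[OF that] arg_cong[OF Bsym, of "\<lambda>M. M $$ (j, 0)"] that B n by simp
  define A' where "A' = mat m m (\<lambda>(i, j). B $$ (Suc i, Suc j))"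
  have A': "A' \<in> carrier_mat m m" by (simp add: A'_def)
  have Bblock: "B = four_block_mat (mat 1 1 (\<lambda>_. e)) (0\<^sub>m 1 m) (0\<^sub>m m 1) A'"
    by (rule eq_matI) (use B n in \<open>auto simp: A'_def B0 B0'\<close>)
  have "A'\<^sup>T = A'"
  proof (rule eq_matI)
    fix i j assume "i < dim_row A'" "j < dim_col A'"
    then show "A'\<^sup>T $$ (i, j) = A' $$ (i, j)"
      using arg_cong[OF Bsym, of "\<lambda>M. M $$ (Suc i, Suc j)"] B n by (simp add: A'_def)
  qed (auto simp: A'_def)
  moreover have "char_poly A' = (\<Prod>a\<leftarrow>es. [:- a, 1:])"
  proof -
    have "similar_mat A B"
      using A B H HBH by (intro similar_matI[of _ _ H H n]) auto
    then have "char_poly A = char_poly B" by (rule char_poly_similar)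
    also have "\<dots> = [:- e, 1:] * char_poly A'"
      unfolding Bblock using A' char_poly_four_block_lower_left_zero[of "mat 1 1 (\<lambda>_. e)" 1 "0\<^sub>m 1 m" m A']
      by (simp add: char_poly_singleton[unfolded One_nat_def])
    finally have "[:- e, 1:] * char_poly A' = [:- e, 1:] * (\<Prod>a\<leftarrow>es. [:- a, 1:])"
      unfolding cp by simp
    then show ?thesis by (subst (asm) mult_left_cancel) auto
  qed
  ultimately obtain U' where U': "U' \<in> carrier_mat m m" "U'\<^sup>T * U' = 1\<^sub>m m" "A' = U' * list_diag_mat es * U'\<^sup>T"
    using Cons.IH[OF A'] by blast
  let ?one = "1\<^sub>m 1 :: real mat"
  define V where "V = four_block_mat ?one (0\<^sub>m 1 m) (0\<^sub>m m 1) U'"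
  have V: "V \<in> carrier_mat n n" using U' by (auto simp: V_def n)
  have VT: "V\<^sup>T = four_block_mat ?one (0\<^sub>m 1 m) (0\<^sub>m m 1) U'\<^sup>T"
    unfolding V_def using U' by (subst transpose_four_block_mat[of _ 1 1 _ m _ m]) auto
  have VV: "V\<^sup>T * V = 1\<^sub>m n"
    unfolding VT unfolding V_def using U'
    by (subst mult_four_block_mat[of _ 1 1 _ m _ m _ _ 1 _ m]) (auto simp: n)
  have D: "list_diag_mat es \<in> carrier_mat m m" by (simp add: m_def)
  have D': "list_diag_mat (e # es) \<in> carrier_mat n n" by (simp add: n m_def)
  have "V * list_diag_mat (e # es) = four_block_mat (mat 1 1 (\<lambda>_. e)) (0\<^sub>m 1 m) (0\<^sub>m m 1) (U' * list_diag_mat es)"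
    unfolding V_def list_diag_mat_Cons m_def[symmetric] using U' D
    by (subst mult_four_block_mat[of _ 1 1 _ m _ m _ _ 1 _ m]) auto
  also have "\<dots> * V\<^sup>T = B"
    unfolding VT Bblock using U' D
    by (subst mult_four_block_mat[of _ 1 1 _ m _ m _ _ 1 _ m]) auto
  finally have VDV: "V * list_diag_mat (e # es) * V\<^sup>T = B" .
  define U where "U = H * V"
  have U: "U \<in> carrier_mat n n" using H V by (auto simp: U_def)
  have UT: "U\<^sup>T = V\<^sup>T * H" unfolding U_def using H V by (simp add: transpose_mult[of _ n n _ n])
  have "U\<^sup>T * U = V\<^sup>T * (H * H) * V"
    unfolding UT unfolding U_def using H(1) V by (simp add: assoc_mult_mat[of _ n n _ n _ n])
  then have "U\<^sup>T * U = 1\<^sub>m n" using H V VV by simp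
  moreover have "U * list_diag_mat (e # es) * U\<^sup>T = H * (V * list_diag_mat (e # es) * V\<^sup>T) * H"
    unfolding UT unfolding U_def using H(1) V D' by (simp add: assoc_mult_mat[of _ n n _ n _ n])
  ultimately show ?case using U HBH VDV by auto
qed

section \<open>Quadratic forms in orthonormal bases\<close>

definition quad_form :: "real mat \<Rightarrow> (nat \<Rightarrow> real) \<Rightarrow> real" where
  "quad_form M x = (\<Sum>i<dim_row M. \<Sum>j<dim_col M. M $$ (i, j) * (x i * x j))"

lemma symmetric_mat_eigenbasis:
  fixes M :: "real mat"
  assumes M: "M \<in> carrier_mat n n" and sym: "M\<^sup>T = M" and es: "mset es = proots (char_poly M)"
  obtains u :: "nat \<Rightarrow> nat \<Rightarrow> real" where
    "\<And>k l. k < n \<Longrightarrow> l < n \<Longrightarrow> (\<Sum>i<n. u k i * u l i) = (if k = l then 1 else 0)"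
    "\<And>i j. i < n \<Longrightarrow> j < n \<Longrightarrow> (\<Sum>k<n. u k i * u k j) = (if i = j then 1 else 0)"
    "\<And>x. quad_form M x = (\<Sum>k<n. es ! k * (\<Sum>i<n. u k i * x i)\<^sup>2)"
proof -
  have len: "length es = n" using size_proots_symmetric[OF M sym] es by (metis size_mset)
  obtain U where U: "U \<in> carrier_mat n n" "U\<^sup>T * U = 1\<^sub>m n" and MU: "M = U * list_diag_mat es * U\<^sup>T"
    using symmetric_mat_spectral[OF M sym char_poly_eq_prod_list[OF M es len]] by blast
  have UU: "U * U\<^sup>T = 1\<^sub>m n"
    using mat_mult_left_right_inverse[of "U\<^sup>T" n U] U by simp
  define u where "u k i = U $$ (i, k)" for k i
  have entry: "M $$ (i, j) = (\<Sum>k<n. es ! k * u k i * u k j)" if ij: "i < n" "j < n" for i j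
  proof -
    have UD: "(U * list_diag_mat es) $$ (i, k) = es ! k * u k i" if k: "k < n" for k
    proof -
      have "(U * list_diag_mat es) $$ (i, k) = (\<Sum>l<n. U $$ (i, l) * (if l = k then es ! l else 0))"
        using U ij k len by (simp add: list_diag_mat_def scalar_prod_def lessThan_atLeast0)
      also have "\<dots> = (\<Sum>l<n. if l = k then es ! k * u k i else 0)"
        by (intro sum.cong refl) (auto simp: u_def)
      finally show ?thesis using k by simp
    qed
    have prod: "(P * U\<^sup>T) $$ (i, j) = (\<Sum>k<n. P $$ (i, k) * U $$ (j, k))" if "P \<in> carrier_mat n n" for P
      using that U ij by (simp add: scalar_prod_def lessThan_atLeast0)
    have "M $$ (i, j) = (\<Sum>k<n. (U * list_diag_mat es) $$ (i, k) * U $$ (j, k))"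
      unfolding MU by (rule prod) (use U len in auto)
    then show ?thesis by (simp add: UD u_def)
  qed
  show ?thesis
  proof (rule that[of u])
    fix k l assume kl: "k < n" "l < n"
    then have "(\<Sum>i<n. u k i * u l i) = (U\<^sup>T * U) $$ (k, l)"
      using U(1) by (simp add: u_def scalar_prod_def lessThan_atLeast0)
    then show "(\<Sum>i<n. u k i * u l i) = (if k = l then 1 else 0)"
      using U(2) kl by simp
  next
    fix k l assume kl: "k < n" "l < n"
    then have "(\<Sum>i<n. u i k * u i l) = (U * U\<^sup>T) $$ (k, l)"
      using U(1) by (simp add: u_def scalar_prod_def lessThan_atLeast0)
    then show "(\<Sum>i<n. u i k * u i l) = (if k = l then 1 else 0)"
      using UU kl by simp
  next
    fix x
    have "quad_form M x = (\<Sum>i<n. \<Sum>j<n. \<Sum>k<n. es ! k * ((u k i * x i) * (u k j * x j)))"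
      unfolding quad_form_def using M by (auto simp: entry sum_distrib_left sum_distrib_right mult_ac intro!: sum.cong)
    also have "\<dots> = (\<Sum>i<n. \<Sum>k<n. \<Sum>j<n. es ! k * ((u k i * x i) * (u k j * x j)))"
      by (intro sum.cong refl sum.swap)
    also have "\<dots> = (\<Sum>k<n. \<Sum>i<n. \<Sum>j<n. es ! k * ((u k i * x i) * (u k j * x j)))"
      by (rule sum.swap)
    also have "\<dots> = (\<Sum>k<n. es ! k * (\<Sum>i<n. u k i * x i)\<^sup>2)"
      unfolding power2_eq_square sum_product by (simp add: sum_distrib_left)
    finally show "quad_form M x = (\<Sum>k<n. es ! k * (\<Sum>i<n. u k i * x i)\<^sup>2)" .
  qed
qed

lemma parseval_orthonormal:
  fixes u :: "nat \<Rightarrow> nat \<Rightarrow> real"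
  assumes "\<And>i j. i < n \<Longrightarrow> j < n \<Longrightarrow> (\<Sum>k<n. u k i * u k j) = (if i = j then 1 else 0)"
  shows "(\<Sum>k<n. (\<Sum>i<n. u k i * x i)\<^sup>2) = (\<Sum>i<n. x i * x i)"
proof -
  have "(\<Sum>k<n. (\<Sum>i<n. u k i * x i)\<^sup>2) = (\<Sum>k<n. \<Sum>i<n. \<Sum>j<n. (x i * x j) * (u k i * u k j))"
    unfolding power2_eq_square sum_product by (simp add: mult_ac)
  also have "\<dots> = (\<Sum>i<n. \<Sum>k<n. \<Sum>j<n. (x i * x j) * (u k i * u k j))"
    by (rule sum.swap)
  also have "\<dots> = (\<Sum>i<n. \<Sum>j<n. \<Sum>k<n. (x i * x j) * (u k i * u k j))"
    by (intro sum.cong refl sum.swap)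
  also have "\<dots> = (\<Sum>i<n. \<Sum>j<n. (x i * x j) * (if i = j then 1 else 0))"
    unfolding sum_distrib_left[symmetric] using assms by (intro sum.cong refl arg_cong2[of _ _ _ _ "(*)"]) auto
  also have "\<dots> = (\<Sum>i<n. \<Sum>j<n. if j = i then x i * x i else 0)"
    by (intro sum.cong refl) auto
  finally show ?thesis by simp
qed

lemma sum_quad_form_orthonormal:
  fixes u :: "nat \<Rightarrow> nat \<Rightarrow> real"
  assumes u: "\<And>i j. i < n \<Longrightarrow> j < n \<Longrightarrow> (\<Sum>k<n. u k i * u k j) = (if i = j then 1 else 0)"
    and M: "M \<in> carrier_mat n n"
  shows "(\<Sum>k<n. quad_form M (u k)) = (\<Sum>i<n. M $$ (i, i))"
proof -
  have "(\<Sum>k<n. quad_form M (u k)) = (\<Sum>k<n. \<Sum>i<n. \<Sum>j<n. M $$ (i, j) * (u k i * u k j))"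
    using M by (simp add: quad_form_def)
  also have "\<dots> = (\<Sum>i<n. \<Sum>k<n. \<Sum>j<n. M $$ (i, j) * (u k i * u k j))"
    by (rule sum.swap)
  also have "\<dots> = (\<Sum>i<n. \<Sum>j<n. \<Sum>k<n. M $$ (i, j) * (u k i * u k j))"
    by (intro sum.cong refl sum.swap)
  also have "\<dots> = (\<Sum>i<n. \<Sum>j<n. M $$ (i, j) * (if i = j then 1 else 0))"
    unfolding sum_distrib_left[symmetric] using u by (intro sum.cong refl arg_cong2[of _ _ _ _ "(*)"]) auto
  also have "\<dots> = (\<Sum>i<n. \<Sum>j<n. if j = i then M $$ (i, i) else 0)"
    by (intro sum.cong refl) auto
  finally show ?thesis by simp
qed

text \<open>Ky Fan's argument, evaluating the forms at the first \<open>k\<close> eigenvectors of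
  \<open>A\<close>. Each eigenvalue of \<open>B\<close> is at most \<open>\<theta>\<close> plus its
  positive excess \<open>g\<close>; the \<open>\<theta>\<close>-parts give
  \<open>k * \<theta>\<close>, every excess has total weight at most 1, and the nonnegative forms of
  \<open>E\<close> extend to the full basis, where they sum to the trace.\<close>

theorem sum_eigenvalues_le_of_quad_form_le:
  fixes A B E :: "real mat"
  assumes A: "A \<in> carrier_mat n n" "A\<^sup>T = A" and B: "B \<in> carrier_mat n n" "B\<^sup>T = B"
    and E: "E \<in> carrier_mat n n" and E_nonneg: "\<And>x. quad_form E x \<ge> 0"
    and le: "\<And>x. quad_form A x \<le> quad_form B x + quad_form E x"
    and es: "mset es = proots (char_poly A)" and k: "k \<le> n"
  shows "sum_list (take k es)
    \<le> real k * \<theta> + (\<Sum>x\<in>#proots (char_poly B). max (x - \<theta>) 0) + (\<Sum>i<n. E $$ (i, i))"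
proof -
  obtain fs where fs: "mset fs = proots (char_poly B)" using ex_mset by blast
  have len: "length es = n" "length fs = n"
    using size_proots_symmetric[OF A] size_proots_symmetric[OF B] es fs by (metis size_mset)+
  obtain u where u: "\<And>k l. k < n \<Longrightarrow> l < n \<Longrightarrow> (\<Sum>i<n. u k i * u l i) = (if k = l then 1 else 0)"
    and u': "\<And>i j. i < n \<Longrightarrow> j < n \<Longrightarrow> (\<Sum>k<n. u k i * u k j) = (if i = j then 1 else 0)"
    and qA: "\<And>x. quad_form A x = (\<Sum>k<n. es ! k * (\<Sum>i<n. u k i * x i)\<^sup>2)"
    using symmetric_mat_eigenbasis[OF A es] by blast
  obtain w where w: "\<And>k l. k < n \<Longrightarrow> l < n \<Longrightarrow> (\<Sum>i<n. w k i * w l i) = (if k = l then 1 else 0)"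
    and w': "\<And>i j. i < n \<Longrightarrow> j < n \<Longrightarrow> (\<Sum>k<n. w k i * w k j) = (if i = j then 1 else 0)"
    and qB: "\<And>x. quad_form B x = (\<Sum>k<n. fs ! k * (\<Sum>i<n. w k i * x i)\<^sup>2)"
    using symmetric_mat_eigenbasis[OF B fs] by blast
  \<comment> \<open>Squared inner products of the two orthonormal bases; by Parseval this array is
    doubly stochastic.\<close>
  define a where "a j l = (\<Sum>i<n. w j i * u l i)\<^sup>2" for j l
  define g where "g j = max (fs ! j - \<theta>) 0" for j
  have qAu: "quad_form A (u l) = es ! l" if "l < n" for l
  proof -
    have "quad_form A (u l) = (\<Sum>k<n. if k = l then es ! l else 0)"
      unfolding qA using u that by (intro sum.cong refl) auto
    then show ?thesis using that by simp
  qed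
  have qBu: "quad_form B (u l) \<le> \<theta> + (\<Sum>j<n. g j * a j l)" if l: "l < n" for l
  proof -
    have one: "(\<Sum>j<n. a j l) = 1"
      using parseval_orthonormal[of n w "u l", OF w'] u[OF l l] by (simp add: a_def)
    have "quad_form B (u l) = (\<Sum>j<n. fs ! j * a j l)" unfolding qB a_def ..
    also have "\<dots> = (\<Sum>j<n. \<theta> * a j l + (fs ! j - \<theta>) * a j l)"
      by (simp add: algebra_simps)
    also have "\<dots> = \<theta> + (\<Sum>j<n. (fs ! j - \<theta>) * a j l)"
      unfolding sum.distrib sum_distrib_left[symmetric] one by simp
    also have "\<dots> \<le> \<theta> + (\<Sum>j<n. g j * a j l)"
      by (intro add_left_mono sum_mono mult_right_mono) (auto simp: g_def a_def)
    finally show ?thesis .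
  qed
  have "sum_list (take k es) = (\<Sum>l<k. es ! l)"
    using k len by (simp add: sum_list_sum_nth lessThan_atLeast0)
  also have "\<dots> \<le> (\<Sum>l<k. (\<theta> + (\<Sum>j<n. g j * a j l)) + quad_form E (u l))"
  proof (rule sum_mono)
    fix l assume "l \<in> {..<k}"
    then have "l < n" using k by simp
    then show "es ! l \<le> (\<theta> + (\<Sum>j<n. g j * a j l)) + quad_form E (u l)"
      using le[of "u l"] qAu[of l] qBu[of l] by simp
  qed
  also have "\<dots> = real k * \<theta> + (\<Sum>l<k. \<Sum>j<n. g j * a j l) + (\<Sum>l<k. quad_form E (u l))"
    by (simp add: sum.distrib)
  also have "(\<Sum>l<k. \<Sum>j<n. g j * a j l) = (\<Sum>j<n. g j * (\<Sum>l<k. a j l))"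
    by (subst sum.swap) (simp add: sum_distrib_left)
  finally have main: "sum_list (take k es)
      \<le> real k * \<theta> + (\<Sum>j<n. g j * (\<Sum>l<k. a j l)) + (\<Sum>l<k. quad_form E (u l))" .
  have "(\<Sum>j<n. g j * (\<Sum>l<k. a j l)) \<le> (\<Sum>j<n. g j * 1)"
  proof (intro sum_mono mult_left_mono)
    fix j assume j: "j \<in> {..<n}"
    have "(\<Sum>l<k. a j l) \<le> (\<Sum>l<n. a j l)"
      using k by (intro sum_mono2) (auto simp: a_def)
    also have "\<dots> = (\<Sum>l<n. (\<Sum>i<n. u l i * w j i)\<^sup>2)" by (simp add: a_def mult.commute)
    also have "\<dots> = 1" using parseval_orthonormal[of n u "w j", OF u'] w j by simp
    finally show "(\<Sum>l<k. a j l) \<le> 1" .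
  qed (simp add: g_def)
  also have "\<dots> = (\<Sum>x\<in>#mset fs. max (x - \<theta>) 0)"
    using len by (simp add: g_def sum_mset_sum_list sum_list_sum_nth lessThan_atLeast0 flip: mset_map)
  finally have "(\<Sum>j<n. g j * (\<Sum>l<k. a j l)) \<le> (\<Sum>x\<in>#proots (char_poly B). max (x - \<theta>) 0)"
    unfolding fs .
  moreover have "(\<Sum>l<k. quad_form E (u l)) \<le> (\<Sum>l<n. quad_form E (u l))"
    using k E_nonneg by (intro sum_mono2) auto
  moreover have "(\<Sum>l<n. quad_form E (u l)) = (\<Sum>i<n. E $$ (i, i))"
    by (rule sum_quad_form_orthonormal[OF u' E])
  ultimately show ?thesis using main by linarith
qed

section \<open>Laplacian eigenvalue sums of graphs\<close>

lemma char_poly_permute: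
  fixes A :: "'a :: field mat"
  assumes A: "A \<in> carrier_mat n n" and \<pi>: "\<pi> permutes {..<n}"
  shows "char_poly (mat n n (\<lambda>(i, j). A $$ (\<pi> i, \<pi> j))) = char_poly A"
proof -
  define P where "P = mat n n (\<lambda>(i, j). if j = \<pi> i then 1 else 0 :: 'a)"
  have P: "P \<in> carrier_mat n n" by (simp add: P_def)
  have \<pi>_less: "\<pi> i < n" if "i < n" for i
    using permutes_in_image[OF \<pi>, of i] that by simp
  have PM: "P * M = mat n n (\<lambda>(i, j). M $$ (\<pi> i, j))" if M: "M \<in> carrier_mat n n" for M
  proof (rule eq_matI)
    fix i j assume "i < dim_row (mat n n (\<lambda>(i, j). M $$ (\<pi> i, j)))" "j < dim_col (mat n n (\<lambda>(i, j). M $$ (\<pi> i, j)))"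
    then have ij: "i < n" "j < n" by auto
    then have "(P * M) $$ (i, j) = (\<Sum>k<n. (if k = \<pi> i then 1 else 0) * M $$ (k, j))"
      using M by (simp add: P_def scalar_prod_def lessThan_atLeast0)
    also have "\<dots> = (\<Sum>k<n. if k = \<pi> i then M $$ (\<pi> i, j) else 0)"
      by (intro sum.cong refl) auto
    finally show "(P * M) $$ (i, j) = mat n n (\<lambda>(i, j). M $$ (\<pi> i, j)) $$ (i, j)"
      using ij \<pi>_less by simp
  qed (use P M in auto)
  have PT: "M * P\<^sup>T = mat n n (\<lambda>(i, j). M $$ (i, \<pi> j))" if M: "M \<in> carrier_mat n n" for M
  proof -
    have "(M * P\<^sup>T)\<^sup>T = P * M\<^sup>T" using M P by (simp add: transpose_mult[of _ n n _ n])
    also have "\<dots> = (mat n n (\<lambda>(i, j). M $$ (i, \<pi> j)))\<^sup>T"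
      using M \<pi>_less by (subst PM) (auto intro!: eq_matI)
    finally show ?thesis by (metis Matrix.transpose_transpose)
  qed
  have PP: "P * P\<^sup>T = 1\<^sub>m n"
  proof -
    have "P * P\<^sup>T = mat n n (\<lambda>(i, j). P $$ (i, \<pi> j))" by (rule PT[OF P])
    also have "\<dots> = 1\<^sub>m n"
      using \<pi>_less permutes_inj[OF \<pi>] by (intro eq_matI) (auto simp: P_def inj_eq)
    finally show ?thesis .
  qed
  have PP': "P\<^sup>T * P = 1\<^sub>m n"
    using mat_mult_left_right_inverse[OF P _ PP] P by simp
  have "P * A * P\<^sup>T = mat n n (\<lambda>(i, j). A $$ (\<pi> i, \<pi> j))"
    using A \<pi>_less by (subst PM[OF A], subst PT) (auto intro!: eq_matI)
  then have "similar_mat (mat n n (\<lambda>(i, j). A $$ (\<pi> i, \<pi> j))) A"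
    using P A PP PP' by (intro similar_matI[of _ _ P "P\<^sup>T" n]) auto
  then show ?thesis by (rule char_poly_similar)
qed

lemma laplacian_mat_carrier: "laplacian_mat G vs \<in> carrier_mat (length vs) (length vs)"
  by (auto simp: laplacian_mat_def degree_mat_def adjacency_mat_def)

lemma laplacian_mat_entry:
  "i < length vs \<Longrightarrow> j < length vs \<Longrightarrow> laplacian_mat G vs $$ (i, j)
    = (if i = j then real (out_degree G (vs ! i)) else 0) - (if vs ! i \<rightarrow>\<^bsub>G\<^esub> vs ! j then 1 else 0)"
  by (simp add: laplacian_mat_def degree_mat_def adjacency_mat_def)

text \<open>Reordering the vertices conjugates the Laplacian by a permutation matrix, so an
  enumeration listing \<open>Q\<close> before \<open>P\<close> may be chosen.\<close>

lemma laplacian_sum_cong: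
  assumes "mset vs = mset vs'"
  shows "laplacian_sum G vs k = laplacian_sum G vs' k"
proof -
  obtain \<pi> where \<pi>: "\<pi> permutes {..<length vs'}" "permute_list \<pi> vs' = vs"
    using mset_eq_permutation[OF assms] .
  have len: "length vs = length vs'" using assms by (rule mset_eq_length)
  have \<pi>_less: "\<pi> i < length vs'" if "i < length vs'" for i
    using permutes_in_image[OF \<pi>(1), of i] that by simp
  have nth: "vs ! i = vs' ! \<pi> i" if "i < length vs'" for i
    using that \<pi> permute_list_nth[OF \<pi>(1)] by metis
  have "laplacian_mat G vs = mat (length vs') (length vs') (\<lambda>(i, j). laplacian_mat G vs' $$ (\<pi> i, \<pi> j))"
  proof (rule eq_matI)
    fix i j assume "i < dim_row (mat (length vs') (length vs') (\<lambda>(i, j). laplacian_mat G vs' $$ (\<pi> i, \<pi> j)))"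
      "j < dim_col (mat (length vs') (length vs') (\<lambda>(i, j). laplacian_mat G vs' $$ (\<pi> i, \<pi> j)))"
    then show "laplacian_mat G vs $$ (i, j) = mat (length vs') (length vs') (\<lambda>(i, j). laplacian_mat G vs' $$ (\<pi> i, \<pi> j)) $$ (i, j)"
      using len \<pi>_less permutes_inj[OF \<pi>(1)] by (simp add: laplacian_mat_entry nth inj_eq)
  qed (use len laplacian_mat_carrier[of G vs] in auto)
  then have "char_poly (laplacian_mat G vs) = char_poly (laplacian_mat G vs')"
    using char_poly_permute[OF laplacian_mat_carrier \<pi>(1)] by simp
  then show ?thesis by (simp add: laplacian_sum_def laplacian_eigenvalues_def)
qed

text \<open>The diagonal values \<open>f i i\<close> cancel, so a clique can be encoded by weight 1
  on all pairs, the diagonal included.\<close>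

definition weighted_laplacian :: "nat \<Rightarrow> (nat \<Rightarrow> nat \<Rightarrow> real) \<Rightarrow> real mat" where
  "weighted_laplacian n f = mat n n (\<lambda>(i, j). (if i = j then \<Sum>l<n. f i l else 0) - f i j)"

lemma weighted_laplacian_carrier [simp]: "weighted_laplacian n f \<in> carrier_mat n n"
  by (simp add: weighted_laplacian_def)

lemma transpose_weighted_laplacian:
  "(\<And>i j. i < n \<Longrightarrow> j < n \<Longrightarrow> f i j = f j i) \<Longrightarrow> (weighted_laplacian n f)\<^sup>T = weighted_laplacian n f"
  unfolding weighted_laplacian_def by (rule eq_matI) auto

text \<open>Symmetrising the double sum gives the Dirichlet energy, which reduces nonnegativity and
  comparison of Laplacians to entrywise statements about weights.\<close>

lemma quad_form_weighted_laplacian: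
  assumes f: "\<And>i j. i < n \<Longrightarrow> j < n \<Longrightarrow> f i j = f j i"
  shows "quad_form (weighted_laplacian n f) x = (\<Sum>i<n. \<Sum>j<n. f i j * (x i - x j)\<^sup>2) / 2"
proof -
  have "quad_form (weighted_laplacian n f) x
      = (\<Sum>i<n. \<Sum>j<n. (if j = i then (\<Sum>l<n. f i l) * (x i * x i) else 0) - f i j * (x i * x j))"
    unfolding quad_form_def by (intro sum.cong) (auto simp: weighted_laplacian_def left_diff_distrib)
  also have "\<dots> = (\<Sum>i<n. \<Sum>j<n. f i j * (x i)\<^sup>2 - f i j * (x i * x j))"
    by (simp add: sum_subtractf sum_distrib_right power2_eq_square)
  finally have 1: "quad_form (weighted_laplacian n f) x = (\<Sum>i<n. \<Sum>j<n. f i j * (x i)\<^sup>2 - f i j * (x i * x j))" .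
  also have "\<dots> = (\<Sum>j<n. \<Sum>i<n. f i j * (x i)\<^sup>2 - f i j * (x i * x j))" by (rule sum.swap)
  also have "\<dots> = (\<Sum>i<n. \<Sum>j<n. f i j * (x j)\<^sup>2 - f i j * (x i * x j))"
    using f by (intro sum.cong refl) (auto simp: mult.commute)
  finally have "2 * quad_form (weighted_laplacian n f) x
      = (\<Sum>i<n. \<Sum>j<n. f i j * (x i)\<^sup>2 - f i j * (x i * x j)) + (\<Sum>i<n. \<Sum>j<n. f i j * (x j)\<^sup>2 - f i j * (x i * x j))"
    using 1 by simp
  also have "\<dots> = (\<Sum>i<n. \<Sum>j<n. f i j * (x i - x j)\<^sup>2)"
    unfolding sum.distrib[symmetric] by (intro sum.cong refl) (simp add: power2_eq_square algebra_simps)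
  finally show ?thesis by simp
qed

section \<open>Degrees in a simple graph\<close>

lemma (in graph) dominates_sym: "u \<rightarrow>\<^bsub>G\<^esub> v \<longleftrightarrow> v \<rightarrow>\<^bsub>G\<^esub> u"
  using arcs_ends_symmetric[OF sym_arcs] by blast

lemma (in graph) not_dominates_self: "\<not> u \<rightarrow>\<^bsub>G\<^esub> u"
  by (auto simp: arcs_ends_def arc_to_ends_def) (metis no_loops)

lemma (in graph) out_degree_eq_card: "out_degree G u = card {v \<in> verts G. u \<rightarrow>\<^bsub>G\<^esub> v}"
proof -
  have "inj_on (head G) (out_arcs G u)"
    using no_multi_arcs by (intro inj_onI) (auto simp: out_arcs_def arc_to_ends_def)
  moreover have "head G ` out_arcs G u = {v \<in> verts G. u \<rightarrow>\<^bsub>G\<^esub> v}"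
    by (auto simp: out_arcs_def arcs_ends_def arc_to_ends_def image_iff intro: head_in_verts)
  ultimately show ?thesis unfolding out_degree_def by (metis card_image)
qed

lemma (in graph) out_degree_less: "u \<in> verts G \<Longrightarrow> out_degree G u < card (verts G)"
  unfolding out_degree_eq_card
  by (rule psubset_card_mono) (use not_dominates_self in auto)

lemma (in graph) out_degree_eq_sum:
  assumes "distinct vs" "set vs = verts G"
  shows "real (out_degree G u) = (\<Sum>j<length vs. if u \<rightarrow>\<^bsub>G\<^esub> vs ! j then 1 else 0)"
proof -
  have "real (out_degree G u) = (\<Sum>v\<in>set vs. if u \<rightarrow>\<^bsub>G\<^esub> v then 1 else 0)"
    using assms by (simp add: out_degree_eq_card sum.If_cases Int_def)
  also have "\<dots> = (\<Sum>v\<leftarrow>vs. if u \<rightarrow>\<^bsub>G\<^esub> v then 1 else 0)"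
    by (rule sum.distinct_set_conv_list[OF assms(1)])
  also have "\<dots> = (\<Sum>j<length vs. if u \<rightarrow>\<^bsub>G\<^esub> vs ! j then 1 else 0)"
    by (simp add: sum_list_sum_nth lessThan_atLeast0)
  finally show ?thesis .
qed

text \<open>The adjacency weights are at most \<open>f + e\<close>, where \<open>f\<close> completes
  \<open>Q\<close> to a clique and keeps the crossing edges, and \<open>e\<close> keeps the edges
  inside \<open>P\<close>. With \<open>\<theta> = q\<close>, the excess of \<open>f\<close> costs at
  most the number of crossing edges, and \<open>e\<close> costs its trace, which counts the edges
  inside \<open>P\<close> twice; together this is the degree sum over \<open>P\<close>.\<close>

theorem (in graph) laplacian_sum_le:
  assumes vs: "distinct vs" "set vs = verts G" and P: "P \<subseteq> verts G" and k: "k \<le> card (verts G)"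
  shows "laplacian_sum G vs k \<le> real (card (verts G - P)) * real k + (\<Sum>v\<in>P. real (out_degree G v))"
proof -
  define qs where "qs = filter (\<lambda>v. v \<notin> P) vs"
  define ps where "ps = filter (\<lambda>v. v \<in> P) vs"
  define us where "us = qs @ ps"
  define q where "q = length qs"
  define p where "p = length ps"
  define n where "n = q + p"
  have us: "distinct us" "set us = verts G" and len: "length us = n"
    using vs by (auto simp: us_def qs_def ps_def n_def q_def p_def)
  have ps: "set ps = P" "distinct ps" and qs: "card (verts G - P) = q"
    using vs P distinct_card[of qs] by (auto simp: ps_def qs_def q_def set_diff_eq)
  have n: "n = card (verts G)" using us len distinct_card by metis
  have ps_nth: "us ! (q + v) = ps ! v" for v by (simp add: us_def q_def nth_append)
  define a where "a i j = (if us ! i \<rightarrow>\<^bsub>G\<^esub> us ! j then 1 else 0 :: real)" for i j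
  have a_sym: "a i j = a j i" for i j unfolding a_def using dominates_sym by simp
  have a01: "0 \<le> a i j" "a i j \<le> 1" for i j by (auto simp: a_def)
  have a_refl: "a i i = 0" for i using not_dominates_self by (simp add: a_def)
  have deg: "real (out_degree G (us ! i)) = (\<Sum>l<n. a i l)" for i
    using out_degree_eq_sum[OF us] by (simp add: a_def len)
  interpret bipartite_weights q p "\<lambda>i v. a i (q + v)"
    by unfold_locales (auto simp: a01)
  define f where "f i j = (if i < q \<and> j < q then 1 else if i < q \<or> j < q then a i j else 0)" for i j
  define e where "e i j = (if i < q \<or> j < q then 0 else a i j)" for i j
  have sums: "(\<Sum>l<n. f i l) = real q + d i" if "i < q" for i
    using that unfolding n_def sum_lessThan_add by (simp add: f_def d_def)
  have sums': "(\<Sum>l<n. f (q + v) l) = real q - s v" if "v < p" for v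
    using that sum_b_col[OF that] unfolding n_def sum_lessThan_add by (simp add: f_def a_sym[of "q + v"])
  have A: "laplacian_mat G us = weighted_laplacian n a"
    by (rule eq_matI) (use laplacian_mat_carrier[of G us] len in
        \<open>auto simp: weighted_laplacian_def laplacian_mat_entry deg a_def\<close>)
  have B: "split_laplacian = weighted_laplacian n f"
  proof (rule eq_matI)
    fix i j assume "i < dim_row (weighted_laplacian n f)" "j < dim_col (weighted_laplacian n f)"
    then have ij: "i < n" "j < n" by (auto simp: weighted_laplacian_def)
    show "split_laplacian $$ (i, j) = weighted_laplacian n f $$ (i, j)"
    proof (cases "i < q")
      case True
      then show ?thesis
        using ij sums by (auto simp: split_laplacian_def weighted_laplacian_def n_def f_def)
    next
      case False
      then obtain v where v: "i = q + v" "v < p" using ij by (metis n_def add_diff_inverse_nat nat_add_left_cancel_less)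
      show ?thesis
      proof (cases "j = i")
        case True
        then show ?thesis
          using ij v sums'[OF v(2)] by (simp add: split_laplacian_def weighted_laplacian_def n_def f_def)
      next
        case False
        then show ?thesis
          using ij v by (auto simp: split_laplacian_def weighted_laplacian_def n_def f_def a_sym)
      qed
    qed
  qed (auto simp: weighted_laplacian_def split_laplacian_def n_def)
  have f_sym: "f i j = f j i" and e_sym: "e i j = e j i" for i j
    using a_sym by (auto simp: f_def e_def)
  have q_nonneg: "quad_form (weighted_laplacian n e) x \<ge> 0" for x
    by (subst quad_form_weighted_laplacian) (auto simp: e_sym e_def a01 intro!: sum_nonneg)
  have q_le: "quad_form (weighted_laplacian n a) x
      \<le> quad_form (weighted_laplacian n f) x + quad_form (weighted_laplacian n e) x" for x
  proof -
    have "(\<Sum>i<n. \<Sum>j<n. a i j * (x i - x j)\<^sup>2) \<le> (\<Sum>i<n. \<Sum>j<n. f i j * (x i - x j)\<^sup>2 + e i j * (x i - x j)\<^sup>2)"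
      unfolding distrib_right[symmetric]
      by (intro sum_mono mult_right_mono) (auto simp: f_def e_def a01)
    then show ?thesis
      by (simp add: quad_form_weighted_laplacian a_sym f_sym e_sym sum.distrib flip: add_divide_distrib)
  qed
  have "laplacian_sum G vs k = laplacian_sum G us k"
    using vs by (intro laplacian_sum_cong) (simp add: us_def qs_def ps_def)
  also have "\<dots> \<le> real k * real q + (\<Sum>x\<in>#proots (char_poly split_laplacian). max (x - real q) 0)
      + (\<Sum>i<n. weighted_laplacian n e $$ (i, i))"
    unfolding laplacian_sum_def
  proof (rule sum_eigenvalues_le_of_quad_form_le)
    show "laplacian_mat G us \<in> carrier_mat n n" "(laplacian_mat G us)\<^sup>T = laplacian_mat G us"
      unfolding A by (auto intro!: transpose_weighted_laplacian a_sym)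
    show "split_laplacian \<in> carrier_mat n n" "split_laplacian\<^sup>T = split_laplacian"
      unfolding B by (auto intro!: transpose_weighted_laplacian f_sym)
    show "mset (laplacian_eigenvalues G us) = proots (char_poly (laplacian_mat G us))"
      by (simp add: laplacian_eigenvalues_def)
    show "quad_form (laplacian_mat G us) x \<le> quad_form split_laplacian x + quad_form (weighted_laplacian n e) x" for x
      unfolding A B by (rule q_le)
  qed (use k n q_nonneg in auto)
  also have "(\<Sum>i<n. weighted_laplacian n e $$ (i, i)) = (\<Sum>v<p. \<Sum>w<p. a (q + v) (q + w))"
    unfolding n_def sum_lessThan_add
    by (auto simp: weighted_laplacian_def sum_lessThan_add e_def a_refl)
  finally have "laplacian_sum G vs k \<le> real k * real q + (\<Sum>i<q. d i) + (\<Sum>v<p. \<Sum>w<p. a (q + v) (q + w))"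
    using sum_positive_part_split_laplacian by linarith
  also have "(\<Sum>i<q. d i) = (\<Sum>v<p. \<Sum>i<q. a (q + v) i)"
    unfolding d_def by (subst sum.swap) (simp add: a_sym)
  also have "real k * real q + (\<Sum>v<p. \<Sum>i<q. a (q + v) i) + (\<Sum>v<p. \<Sum>w<p. a (q + v) (q + w))
      = real q * real k + (\<Sum>v<p. \<Sum>l<n. a (q + v) l)"
    unfolding n_def sum_lessThan_add sum.distrib by simp
  also have "(\<Sum>v<p. \<Sum>l<n. a (q + v) l) = (\<Sum>v<p. real (out_degree G (ps ! v)))"
    by (simp add: deg[symmetric] ps_nth)
  also have "\<dots> = (\<Sum>v\<leftarrow>ps. real (out_degree G v))"
    by (simp add: sum_list_sum_nth lessThan_atLeast0 p_def)
  also have "\<dots> = (\<Sum>v\<in>P. real (out_degree G v))"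
    using ps by (metis sum.distinct_set_conv_list)
  finally show ?thesis using qs by simp
qed

text \<open>Put \<open>h k = (n - p) * k - k * (k + 1) / 2\<close>. The first hypothesis is the
  claim at \<open>k = x\<close>, and the second says \<open>h k \<le> h x\<close>, since
  \<open>h x - h k\<close> is half of that product.\<close>

lemma concave_bound:
  fixes k x n p m r :: real
  assumes "m \<ge> x * n - x * (x + 1) / 2 - (x - r) * p" "(x - k) * (2 * (n - p) - (x + k + 1)) \<ge> 0"
  shows "(n - p) * k + p * r \<le> m + k * (k + 1) / 2"
  using assms by (simp add: field_simps)

section \<open>Brouwer's conjecture in the three ranges of \<open>k\<close>\<close>

theorem theorem2p8:
  fixes G :: "('a, 'b) pre_digraph" and vs :: "'a list" and n m p r :: nat
  assumes "graph G" and "Digraph_Component.connected G"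
    and "distinct vs" and "set vs = verts G"
    and "n = card (verts G)" and "n \<ge> 4"
    and "m = card (edges G)"
    and "p = card {v \<in> verts G. out_degree G v = r}" and "p \<ge> 1" and "r \<ge> 1"
  shows
    "(real m \<ge> (2 * real n - real r - 1) * real r / 2 \<longrightarrow>
        (\<forall>k::nat. 1 \<le> k \<and> k \<le> r \<longrightarrow> brouwer_holds G vs k)) \<and>
     (real p < real n / 2 \<and>
      real m \<ge> (real n - 1) * (3 * real n - 1) / 8 - (real n - 1 - 2 * real r) * real p / 2 \<longrightarrow>
        (\<forall>k::nat. r + 1 \<le> k \<and> real k \<le> (real n - 1) / 2 \<longrightarrow> brouwer_holds G vs k)) \<and>
     (real p > real n / 2 \<and>
      real m \<ge> (real n - 1) * (3 * real n - 1) / 8 - (real n - 1 - 2 * real r) * real p / 2 \<longrightarrow>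
        (\<forall>k::nat. (real n - 1) / 2 \<le> real k \<and> k \<le> n \<longrightarrow> brouwer_holds G vs k))"
proof -
  interpret graph G by fact
  define P where "P = {v \<in> verts G. out_degree G v = r}"
  have P: "P \<subseteq> verts G" "finite P" and p: "p = card P"
    using assms(8) by (auto simp: P_def)
  obtain v where "v \<in> P" using p assms(9) by (metis card.empty not_one_le_zero ex_in_conv)
  \<comment> \<open>Since \<open>p \<ge> 1\<close>, some vertex has degree \<open>r\<close>; hence
    every \<open>k \<le> r\<close> is in the range of \<open>laplacian_sum_le\<close>.\<close>
  then have r: "r < n" using out_degree_less[of v] assms(5) by (auto simp: P_def)
  have bound0: "laplacian_sum G vs k \<le> real n * real k" if "k \<le> n" for k
    using laplacian_sum_le[of vs "{}" k] assms that by simp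
  have bound: "laplacian_sum G vs k \<le> (real n - real p) * real k + real p * real r" if "k \<le> n" for k
  proof -
    have "real (card (verts G - P)) = real n - real p"
      using P assms(5) p by (simp add: card_Diff_subset of_nat_diff card_mono)
    moreover have "(\<Sum>v\<in>P. real (out_degree G v)) = real p * real r"
      by (simp add: P_def p)
    ultimately show ?thesis using laplacian_sum_le[of vs P k] P assms that by simp
  qed
  have i: "brouwer_holds G vs k"
    if m: "real m \<ge> (2 * real n - real r - 1) * real r / 2" and k: "k \<le> r" for k
  proof -
    \<comment> \<open>The concavity estimate is used with reference point \<open>r\<close> and
      \<open>p = 0\<close>: the hypothesis on \<open>m\<close> reads
      \<open>m \<ge> r * n - r * (r + 1) / 2\<close>.\<close>
    have "(real r - real k) * (2 * (real n - 0) - (real r + real k + 1)) \<ge> 0"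
      using k r by (intro mult_nonneg_nonneg) auto
    then have "(real n - 0) * real k + 0 * real r \<le> real m + real k * (real k + 1) / 2"
      using m by (intro concave_bound[of "real r"]) (simp_all add: field_simps)
    then show ?thesis
      using bound0[of k] k r assms(7) by (simp add: brouwer_holds_def)
  qed
  \<comment> \<open>Possibly a half-integer; it enters only through the concavity estimate over the
    reals.\<close>
  define x where "x = (real n - 1) / 2"
  have big: "brouwer_holds G vs k"
    if m: "real m \<ge> (real n - 1) * (3 * real n - 1) / 8 - (real n - 1 - 2 * real r) * real p / 2"
      and k: "k \<le> n" and xk: "(x - real k) * (2 * (real n - real p) - (x + real k + 1)) \<ge> 0" for k
  proof -
    have "x * real n - x * (x + 1) / 2 - (x - real r) * real p
        = (real n - 1) * (3 * real n - 1) / 8 - (real n - 1 - 2 * real r) * real p / 2"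
      by (simp add: x_def field_simps)
    then have "(real n - real p) * real k + real p * real r \<le> real m + real k * (real k + 1) / 2"
      using m xk by (intro concave_bound) simp_all
    then show ?thesis
      using bound[OF k] assms(7) by (simp add: brouwer_holds_def)
  qed
  \<comment> \<open>Here \<open>x + k + 1 \<le> 2 * x + 1 = n < 2 * (n - p)\<close>, so both factors
    are nonnegative.\<close>
  have "brouwer_holds G vs k"
    if "real p < real n / 2" "real k \<le> (real n - 1) / 2"
      "real m \<ge> (real n - 1) * (3 * real n - 1) / 8 - (real n - 1 - 2 * real r) * real p / 2" for k
    using that by (intro big mult_nonneg_nonneg) (auto simp: x_def field_simps)
  \<comment> \<open>The comparison reverses: \<open>x + k + 1 \<ge> n > 2 * (n - p)\<close>, so both
    factors are nonpositive.\<close>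
  moreover have "brouwer_holds G vs k"
    if "real p > real n / 2" "(real n - 1) / 2 \<le> real k" "k \<le> n"
      "real m \<ge> (real n - 1) * (3 * real n - 1) / 8 - (real n - 1 - 2 * real r) * real p / 2" for k
    using that by (intro big mult_nonpos_nonpos) (auto simp: x_def field_simps)
  ultimately show ?thesis using i by blast
qed

end
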